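(* Let $k_0\in\mathbb{N}$. A bounded weighted shift $S_{\boldsymbol{\lambda}}$ on the directed tree $\mathcal{T}^1_{k_0}=(V,E)$ is cyclic if and only if the weighted bilateral shift operator $W\in\mathcal{B}(\ell^2(\mathbb{Z}))$, $We_k=\lambda_{k+1}e_{k+1}$ $(k\in\mathbb{Z})$, is cyclic. In particular, if $S_{\boldsymbol{\lambda}}$ is contractive and $S_{\boldsymbol{\lambda}}\notin C_{\cdot0}(\ell^2(V))$, then $S_{\boldsymbol{\lambda}}$ is cyclic.
   Context: $\mathcal{T}^1_{k_0}=(V,E)$ is the directed tree with vertex set $V=\mathbb{Z}\cup\{1',2',\dots,k_0'\}$ (the primed symbols are distinct additional vertices) and edge set $E=\{(k,k+1)\colon k\in\mathbb{Z}\}\cup\{(0,1')\}\cup\{(k',(k+1)')\colon k\in\mathbb{N},\,k<k_0\}$. For $u\in V$, $\mathrm{Chi}(u)=\{v\in V\colon(u,v)\in E\}$. Given a bounded family of positive weights $\boldsymbol{\lambda}=\{\lambda_v\colon v\in V\}\subseteq(0,\infty)$, the weighted shift $S_{\boldsymbol{\lambda}}$ is the bounded operator on the complex Hilbert space $\ell^2(V)$ (with orthonormal basis $\{e_u\}_{u\in V}$) given by $S_{\boldsymbol{\lambda}}e_u=\sum_{v\in\mathrm{Chi}(u)}\lambda_ve_v$ (all weights are assumed positive). It is contractive if $\|S_{\boldsymbol{\lambda}}\|\le1$. A contraction $T\in\mathcal{B}(\mathcal{H})$ belongs to $C_{\cdot0}(\mathcal{H})$ if $\|T^{*n}h\|\to0$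 for all $h\in\mathcal{H}$. An operator $T\in\mathcal{B}(\mathcal{H})$ is cyclic if there is $h\in\mathcal{H}$ such that the closed linear span of $\{T^nh\colon n\ge0\}$ is $\mathcal{H}$. *)

theory Defs
  imports "HOL-Analysis.Analysis" "HOL-Library.Function_Algebras"
begin

section \<open>The Hilbert space of square-summable families\<close>

text \<open>
  The index set \<open>A\<close> is an explicit carrier, because the vertex set of the tree depends on a
  natural number. Vectors are total functions that vanish outside \<open>A\<close>, so that equality of
  vectors is equality of functions. Addition of vectors is the pointwise addition of
  \<^theory>\<open>HOL-Library.Function_Algebras\<close>.
\<close>

definition ell2 :: "'a set \<Rightarrow> ('a \<Rightarrow> complex) set" where
  "ell2 A = {f. (\<forall>x. x \<notin> A \<longrightarrow> f x = 0) \<and> (\<lambda>x. (cmod (f x))\<^sup>2) summable_on A}"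

definition ell2_inner :: "'a set \<Rightarrow> ('a \<Rightarrow> complex) \<Rightarrow> ('a \<Rightarrow> complex) \<Rightarrow> complex" where
  "ell2_inner A f g = (\<Sum>\<^sub>\<infinity>x\<in>A. f x * cnj (g x))"

definition ell2_norm :: "'a set \<Rightarrow> ('a \<Rightarrow> complex) \<Rightarrow> real" where
  "ell2_norm A f = sqrt (\<Sum>\<^sub>\<infinity>x\<in>A. (cmod (f x))\<^sup>2)"

definition ell2_dist :: "'a set \<Rightarrow> ('a \<Rightarrow> complex) \<Rightarrow> ('a \<Rightarrow> complex) \<Rightarrow> real" where
  "ell2_dist A f g = ell2_norm A (f - g)"

definition ket :: "'a \<Rightarrow> 'a \<Rightarrow> complex" where
  "ket u = (\<lambda>v. if v = u then 1 else 0)"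

definition scale_fun :: "complex \<Rightarrow> ('a \<Rightarrow> complex) \<Rightarrow> 'a \<Rightarrow> complex" where
  "scale_fun c f = (\<lambda>x. c * f x)"

interpretation complex_fun: vector_space "scale_fun :: complex \<Rightarrow> ('a \<Rightarrow> complex) \<Rightarrow> 'a \<Rightarrow> complex"
  by unfold_locales (auto simp: scale_fun_def fun_eq_iff algebra_simps)

lemma ell2_norm_nonneg [simp]: "0 \<le> ell2_norm A f"
  by (simp add: ell2_norm_def infsum_nonneg)

lemma L2_set_le_ell2_norm:
  assumes "f \<in> ell2 A" "finite F" "F \<subseteq> A"
  shows "L2_set (\<lambda>x. cmod (f x)) F \<le> ell2_norm A f"
  using assms unfolding L2_set_def ell2_norm_def ell2_def
  by (auto intro!: finite_sum_le_infsum)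

lemma ell2I_bounded:
  assumes "\<And>x. x \<notin> A \<Longrightarrow> f x = 0" "0 \<le> C"
    and bd: "\<And>F. finite F \<Longrightarrow> F \<subseteq> A \<Longrightarrow> (\<Sum>x\<in>F. (cmod (f x))\<^sup>2) \<le> C\<^sup>2"
  shows "f \<in> ell2 A" and "ell2_norm A f \<le> C"
proof -
  have s: "(\<lambda>x. (cmod (f x))\<^sup>2) summable_on A"
    by (rule nonneg_bdd_above_summable_on) (use bd in \<open>auto intro!: bdd_aboveI2[where M = "C\<^sup>2"]\<close>)
  then show "f \<in> ell2 A"
    using assms(1) by (simp add: ell2_def)
  have "(\<Sum>\<^sub>\<infinity>x\<in>A. (cmod (f x))\<^sup>2) \<le> C\<^sup>2"
    by (rule infsum_le_finite_sums[OF s bd])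
  then show "ell2_norm A f \<le> C"
    using \<open>0 \<le> C\<close> unfolding ell2_norm_def by (intro real_le_lsqrt) auto
qed

lemma ell2_diff_triangle:
  assumes f: "f \<in> ell2 A" and g: "g \<in> ell2 A"
  shows ell2_diff: "f - g \<in> ell2 A"
    and ell2_norm_diff_le: "ell2_norm A (f - g) \<le> ell2_norm A f + ell2_norm A g"
proof -
  have "(\<Sum>x\<in>F. (cmod ((f - g) x))\<^sup>2) \<le> (ell2_norm A f + ell2_norm A g)\<^sup>2"
    if F: "finite F" "F \<subseteq> A" for F
  proof -
    have "L2_set (\<lambda>x. cmod ((f - g) x)) F \<le> L2_set (\<lambda>x. cmod (f x) + cmod (g x)) F"
      by (rule L2_set_mono) (auto intro: norm_triangle_ineq4)
    also have "\<dots> \<le> L2_set (\<lambda>x. cmod (f x)) F + L2_set (\<lambda>x. cmod (g x)) F"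
      by (rule L2_set_triangle_ineq)
    also have "\<dots> \<le> ell2_norm A f + ell2_norm A g"
      using L2_set_le_ell2_norm[OF f F] L2_set_le_ell2_norm[OF g F] by linarith
    finally show ?thesis
      unfolding L2_set_def by (rule sqrt_le_D)
  qed
  note bd = this
  have "(f - g) x = 0" if "x \<notin> A" for x
    using f g that by (auto simp: ell2_def)
  note * = ell2I_bounded[where f = "f - g", OF this _ bd]
  show "f - g \<in> ell2 A" "ell2_norm A (f - g) \<le> ell2_norm A f + ell2_norm A g"
    by (rule *; simp)+
qed

lemma ell2_norm_minus_commute: "ell2_norm A (f - g) = ell2_norm A (g - f)"
  by (simp add: ell2_norm_def norm_minus_commute)

lemma ell2_norm_eq_0_iff:
  assumes "f \<in> ell2 A"
  shows "ell2_norm A f = 0 \<longleftrightarrow> f = 0"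
proof
  assume 0: "ell2_norm A f = 0"
  have "f x = 0" for x
  proof (cases "x \<in> A")
    case True
    then show ?thesis
      using L2_set_le_ell2_norm[OF assms, of "{x}"] 0 by simp
  qed (use assms in \<open>auto simp: ell2_def\<close>)
  then show "f = 0" by auto
qed (simp add: ell2_norm_def)

interpretation ell2: Metric_space "ell2 A" "ell2_dist A" for A :: "'a set"
proof
  fix f g h :: "'a \<Rightarrow> complex"
  show "ell2_dist A f g = ell2_dist A g f"
    unfolding ell2_dist_def by (rule ell2_norm_minus_commute)
  show "ell2_dist A f g = 0 \<longleftrightarrow> f = g" if "f \<in> ell2 A" "g \<in> ell2 A"
    using ell2_norm_eq_0_iff[OF ell2_diff[OF that]] by (simp add: ell2_dist_def)
  show "ell2_dist A f h \<le> ell2_dist A f g + ell2_dist A g h"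
    if "f \<in> ell2 A" "g \<in> ell2 A" "h \<in> ell2 A"
  proof -
    have "ell2_norm A ((f - g) - (h - g)) \<le> ell2_norm A (f - g) + ell2_norm A (h - g)"
      using that by (intro ell2_norm_diff_le ell2_diff)
    then show ?thesis
      by (simp add: ell2_dist_def ell2_norm_minus_commute[of A h g])
  qed
qed (simp add: ell2_dist_def)


section \<open>Bounded operators\<close>

text \<open>The values of an operator outside \<open>ell2 A\<close> are irrelevant.\<close>

definition bounded_operators :: "'a set \<Rightarrow> (('a \<Rightarrow> complex) \<Rightarrow> ('a \<Rightarrow> complex)) set" where
  "bounded_operators A = {T.
     (\<forall>f\<in>ell2 A. T f \<in> ell2 A) \<and>
     (\<forall>f\<in>ell2 A. \<forall>g\<in>ell2 A. T (f + g) = T f + T g) \<and>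
     (\<forall>c. \<forall>f\<in>ell2 A. T (scale_fun c f) = scale_fun c (T f)) \<and>
     (\<exists>M. \<forall>f\<in>ell2 A. ell2_norm A (T f) \<le> M * ell2_norm A f)}"

definition operator_norm :: "'a set \<Rightarrow> (('a \<Rightarrow> complex) \<Rightarrow> ('a \<Rightarrow> complex)) \<Rightarrow> real" where
  "operator_norm A T = (SUP f\<in>{f \<in> ell2 A. ell2_norm A f \<le> 1}. ell2_norm A (T f))"

definition contractive :: "'a set \<Rightarrow> (('a \<Rightarrow> complex) \<Rightarrow> ('a \<Rightarrow> complex)) \<Rightarrow> bool" where
  "contractive A T \<longleftrightarrow> T \<in> bounded_operators A \<and> operator_norm A T \<le> 1"

definition hilbert_adjoint ::
  "'a set \<Rightarrow> (('a \<Rightarrow> complex) \<Rightarrow> ('a \<Rightarrow> complex)) \<Rightarrow> ('a \<Rightarrow> complex) \<Rightarrow> ('a \<Rightarrow> complex)" where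
  "hilbert_adjoint A T g =
     (THE h. h \<in> ell2 A \<and> (\<forall>f\<in>ell2 A. ell2_inner A (T f) g = ell2_inner A f h))"

definition C_dot_0 :: "'a set \<Rightarrow> (('a \<Rightarrow> complex) \<Rightarrow> ('a \<Rightarrow> complex)) set" where
  "C_dot_0 A = {T. contractive A T \<and>
     (\<forall>h\<in>ell2 A. (\<lambda>n. ell2_norm A ((hilbert_adjoint A T ^^ n) h)) \<longlonglongrightarrow> 0)}"

definition cyclic :: "'a set \<Rightarrow> (('a \<Rightarrow> complex) \<Rightarrow> ('a \<Rightarrow> complex)) \<Rightarrow> bool" where
  "cyclic A T \<longleftrightarrow> (\<exists>h\<in>ell2 A.
     ell2.mtopology A closure_of complex_fun.span {(T ^^ n) h |n. True} = ell2 A)"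


section \<open>Weighted shifts on directed trees\<close>

definition Chi :: "'v set \<Rightarrow> ('v \<times> 'v) set \<Rightarrow> 'v \<Rightarrow> 'v set" where
  "Chi V E u = {v \<in> V. (u, v) \<in> E}"

text \<open>The sum over \<open>Chi V E u\<close> is literal only for trees in which every vertex has finitely
  many children, as is the case below.\<close>

definition is_weighted_shift ::
  "'v set \<Rightarrow> ('v \<times> 'v) set \<Rightarrow> ('v \<Rightarrow> real) \<Rightarrow> (('v \<Rightarrow> complex) \<Rightarrow> ('v \<Rightarrow> complex)) \<Rightarrow> bool" where
  "is_weighted_shift V E lam S \<longleftrightarrow> S \<in> bounded_operators V \<and>
     (\<forall>u\<in>V. S (ket u) = (\<Sum>v\<in>Chi V E u. scale_fun (complex_of_real (lam v)) (ket v)))"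

text \<open>\<open>Trunk k\<close> is the integer vertex \<open>k\<close>, and \<open>Branch k\<close> the primed vertex \<open>k'\<close>.\<close>

datatype vertex = Trunk int | Branch nat

definition tree_V :: "nat \<Rightarrow> vertex set" where
  "tree_V k0 = range Trunk \<union> Branch ` {1..k0}"

definition tree_E :: "nat \<Rightarrow> (vertex \<times> vertex) set" where
  "tree_E k0 = {(Trunk k, Trunk (k + 1)) |k. True} \<union> {(Trunk 0, Branch 1)}
     \<union> {(Branch k, Branch (k + 1)) |k. 1 \<le> k \<and> k < k0}"

definition is_bilateral_shift :: "(int \<Rightarrow> real) \<Rightarrow> ((int \<Rightarrow> complex) \<Rightarrow> (int \<Rightarrow> complex)) \<Rightarrow> bool" where
  "is_bilateral_shift w W \<longleftrightarrow> W \<in> bounded_operators UNIV \<and>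
     (\<forall>k. W (ket k) = scale_fun (complex_of_real (w (k + 1))) (ket (k + 1)))"


section \<open>Existence of the shifts for bounded weights\<close>

lemma weighted_composition_bounded:
  fixes m :: "'v \<Rightarrow> complex"
  assumes A: "A = B \<union> C" and inj: "inj_on p B" "inj_on p C" and p: "p ` A \<subseteq> A"
    and m: "\<And>v. v \<in> A \<Longrightarrow> cmod (m v) \<le> M"
  shows "(\<lambda>f v. if v \<in> A then m v * f (p v) else 0) \<in> bounded_operators A" (is "?T \<in> _")
proof -
  define K where "K = sqrt 2 * \<bar>M\<bar>"
  have bd: "(\<Sum>x\<in>F. (cmod (?T f x))\<^sup>2) \<le> (K * ell2_norm A f)\<^sup>2"
    if f: "f \<in> ell2 A" and F: "finite F" "F \<subseteq> A" for f F
  proof -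
    have *: "(\<Sum>x\<in>G. (cmod (f (p x)))\<^sup>2) \<le> (ell2_norm A f)\<^sup>2"
      if G: "finite G" "G \<subseteq> A" "inj_on p G" for G
    proof -
      have "(\<Sum>x\<in>G. (cmod (f (p x)))\<^sup>2) = (\<Sum>y\<in>p ` G. (cmod (f y))\<^sup>2)"
        using G by (simp add: sum.reindex)
      moreover have "L2_set (\<lambda>x. cmod (f x)) (p ` G) \<le> ell2_norm A f"
        using G p by (intro L2_set_le_ell2_norm f) auto
      ultimately show ?thesis
        unfolding L2_set_def by (metis sqrt_le_D)
    qed
    have "(\<Sum>x\<in>F. (cmod (?T f x))\<^sup>2) \<le> (\<Sum>x\<in>F. M\<^sup>2 * (cmod (f (p x)))\<^sup>2)"
      using F m by (intro sum_mono) (auto simp: norm_mult power_mult_distrib intro!: mult_right_mono power_mono)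
    also have "\<dots> = M\<^sup>2 * (\<Sum>x\<in>F. (cmod (f (p x)))\<^sup>2)"
      by (simp add: sum_distrib_left)
    also have "\<dots> \<le> M\<^sup>2 * ((\<Sum>x\<in>F \<inter> B. (cmod (f (p x)))\<^sup>2) + (\<Sum>x\<in>F \<inter> C. (cmod (f (p x)))\<^sup>2))"
    proof (intro mult_left_mono)
      have "F = (F \<inter> B) \<union> (F \<inter> C)" using F A by auto
      then have "(\<Sum>x\<in>F. (cmod (f (p x)))\<^sup>2) = (\<Sum>x\<in>F \<inter> B. (cmod (f (p x)))\<^sup>2)
          + (\<Sum>x\<in>F \<inter> C. (cmod (f (p x)))\<^sup>2) - (\<Sum>x\<in>(F \<inter> B) \<inter> (F \<inter> C). (cmod (f (p x)))\<^sup>2)"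
        using sum_Un[of "F \<inter> B" "F \<inter> C" "\<lambda>x. (cmod (f (p x)))\<^sup>2"] F by simp
      then show "(\<Sum>x\<in>F. (cmod (f (p x)))\<^sup>2)
          \<le> (\<Sum>x\<in>F \<inter> B. (cmod (f (p x)))\<^sup>2) + (\<Sum>x\<in>F \<inter> C. (cmod (f (p x)))\<^sup>2)"
        using sum_nonneg[of "(F \<inter> B) \<inter> (F \<inter> C)" "\<lambda>x. (cmod (f (p x)))\<^sup>2"] by simp
    qed auto
    also have "\<dots> \<le> M\<^sup>2 * ((ell2_norm A f)\<^sup>2 + (ell2_norm A f)\<^sup>2)"
      using F A inj by (intro mult_left_mono add_mono *) (auto intro: inj_on_subset)
    also have "\<dots> = (K * ell2_norm A f)\<^sup>2"
      by (simp add: K_def power_mult_distrib)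
    finally show ?thesis .
  qed
  have K: "0 \<le> K * ell2_norm A f" for f by (simp add: K_def)
  have "?T f \<in> ell2 A" "ell2_norm A (?T f) \<le> K * ell2_norm A f" if "f \<in> ell2 A" for f
    using ell2I_bounded[where f = "?T f" and A = A, OF _ K[of f] bd[OF that]] by simp_all
  then show ?thesis
    unfolding bounded_operators_def
    by (auto simp: scale_fun_def fun_eq_iff algebra_simps intro!: exI[of _ K])
qed

lemma is_weighted_shift_exists:
  assumes "k0 \<ge> 1" and "bounded (lam ` tree_V k0)"
  shows "\<exists>S. is_weighted_shift (tree_V k0) (tree_E k0) lam S"
proof -
  define p where "p v = (case v of Trunk k \<Rightarrow> Trunk (k - 1)
    | Branch k \<Rightarrow> if k = 1 then Trunk 0 else Branch (k - 1))" for v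
  define S where "S = (\<lambda>f v. if v \<in> tree_V k0 then complex_of_real (lam v) * f (p v) else 0)"
  obtain M where M: "\<And>v. v \<in> tree_V k0 \<Longrightarrow> \<bar>lam v\<bar> \<le> M"
    using assms(2) by (auto simp: bounded_iff)
  have "S \<in> bounded_operators (tree_V k0)"
    unfolding S_def
  proof (rule weighted_composition_bounded)
    show "tree_V k0 = range Trunk \<union> Branch ` {1..k0}" by (fact tree_V_def)
    show "inj_on p (range Trunk)" "inj_on p (Branch ` {1..k0})"
      by (auto simp: inj_on_def p_def split: if_splits)
    have "p v \<in> tree_V k0" if "v \<in> tree_V k0" for v
    proof (cases v)
      case (Branch k)
      then have "k = 1 \<or> k - 1 \<in> {1..k0}"
        using that by (auto simp: tree_V_def)
      then show ?thesis
        using Branch by (auto simp: p_def tree_V_def)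
    qed (auto simp: p_def tree_V_def)
    then show "p ` tree_V k0 \<subseteq> tree_V k0"
      by auto
  qed (use M in auto)
  moreover have "S (ket u) = (\<Sum>v\<in>Chi (tree_V k0) (tree_E k0) u. scale_fun (complex_of_real (lam v)) (ket v))"
    if "u \<in> tree_V k0" for u
  proof -
    have chi: "v \<in> Chi (tree_V k0) (tree_E k0) u \<longleftrightarrow> v \<in> tree_V k0 \<and> p v = u" for v
      using assms(1) by (cases v; cases u) (auto simp: Chi_def tree_V_def tree_E_def p_def)
    have "Chi (tree_V k0) (tree_E k0) u \<subseteq>
        (case u of Trunk k \<Rightarrow> {Trunk (k + 1), Branch 1} | Branch k \<Rightarrow> {Branch (k + 1)})"
      by (auto simp: Chi_def tree_E_def)
    then have fin: "finite (Chi (tree_V k0) (tree_E k0) u)"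
      by (rule finite_subset) (auto split: vertex.split)
    have "(\<Sum>v\<in>Chi (tree_V k0) (tree_E k0) u. scale_fun (complex_of_real (lam v)) (ket v)) w = S (ket u) w" for w
    proof -
      have "(\<Sum>v\<in>Chi (tree_V k0) (tree_E k0) u. scale_fun (complex_of_real (lam v)) (ket v)) w
          = (\<Sum>v\<in>Chi (tree_V k0) (tree_E k0) u. scale_fun (complex_of_real (lam v)) (ket v) w)"
        using fin by (induction rule: finite_induct) auto
      also have "\<dots> = (\<Sum>v\<in>Chi (tree_V k0) (tree_E k0) u. if w = v then complex_of_real (lam v) else 0)"
        by (intro sum.cong) (auto simp: scale_fun_def ket_def)
      also have "\<dots> = S (ket u) w"
        using fin chi[of w] by (auto simp: S_def ket_def)
      finally show ?thesis .
    qed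
    then show ?thesis by (simp add: fun_eq_iff)
  qed
  ultimately show ?thesis
    unfolding is_weighted_shift_def by blast
qed

lemma is_bilateral_shift_exists:
  assumes "bounded (range w)"
  shows "\<exists>W. is_bilateral_shift w W"
proof -
  obtain M where M: "\<And>k. \<bar>w k\<bar> \<le> M"
    using assms by (auto simp: bounded_iff)
  have "(\<lambda>f v. if v \<in> UNIV then complex_of_real (w v) * f (v - 1) else 0) \<in> bounded_operators UNIV"
    by (rule weighted_composition_bounded[where B = UNIV and C = "{}" and M = M])
      (use M in \<open>auto simp: inj_on_def\<close>)
  moreover have "(\<lambda>v. complex_of_real (w v) * ket k (v - 1))
      = scale_fun (complex_of_real (w (k + 1))) (ket (k + 1))" for k
    by (auto simp: fun_eq_iff scale_fun_def ket_def)
  ultimately show ?thesis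
    unfolding is_bilateral_shift_def by (intro exI) auto
qed

end

theory Submission
  imports Defs "HOL-Complex_Analysis.Complex_Analysis"
begin

text \<open>
  Weighting the branch suitably gives an embedding \<open>J\<close> of \<open>\<ell>\<^sup>2(\<int>)\<close> with \<open>S J = J W\<close>, so \<open>S\<close> is
  similar to the sum of \<open>W\<close> and a nilpotent shift \<open>N\<close> on the branch. If \<open>f\<close> is cyclic for \<open>W\<close>, then
  \<open>J f + e\<^bsub>1'\<^esub>\<close> is cyclic for \<open>S\<close>: the high powers of \<open>S\<close> kill the second summand, and \<open>W\<close> has
  dense range. Conversely, restriction to the trunk carries cyclic vectors of \<open>S\<close> to those of \<open>W\<close>.

  If \<open>S\<close> is a contraction outside \<open>C\<^sub>\<cdot>\<^sub>0\<close>, then the product of the \<open>\<lambda>\<^sub>k\<close> over \<open>k \<le> 0\<close> is positive,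
  so a bounded diagonal operator with dense range intertwines the unweighted bilateral shift with
  \<open>W\<close>, and it remains to find a cyclic vector of the former, that is, of multiplication by \<open>z\<close> on the
  circle. Such a vector is \<open>h z = exp (-4 / |1 - z|\<^sup>2)\<close>: there are analytic polynomials \<open>r\<close> with
  \<open>r 0 = 1\<close> and \<open>r h\<close> uniformly small, hence \<open>z\<^sup>-\<^sup>1 h\<close> lies in the invariant subspace generated by
  \<open>h\<close>, which therefore contains \<open>\<phi> h\<close> for all continuous \<open>\<phi>\<close>.
\<close>

section \<open>Closed subspaces and bounded linear maps\<close>

lemma ell2_outside: "f \<in> ell2 A \<Longrightarrow> x \<notin> A \<Longrightarrow> f x = 0"
  by (simp add: ell2_def)

lemma ell2_summable: "f \<in> ell2 A \<Longrightarrow> (\<lambda>x. (cmod (f x))\<^sup>2) summable_on A"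
  by (simp add: ell2_def)

lemma ell2_norm_zero [simp]: "ell2_norm A 0 = 0"
  by (simp add: ell2_norm_def)

lemma ell2_zero [simp]: "0 \<in> ell2 A"
  by (simp add: ell2_def)

lemma ell2_scale: "f \<in> ell2 A \<Longrightarrow> scale_fun c f \<in> ell2 A"
  by (auto simp: ell2_def scale_fun_def norm_mult power_mult_distrib intro: summable_on_cmult_right)

lemma ell2_norm_scale: "ell2_norm A (scale_fun c f) = cmod c * ell2_norm A f"
  by (simp add: ell2_norm_def scale_fun_def norm_mult power_mult_distrib infsum_cmult_right'
      real_sqrt_mult)

lemma scale_fun_minus_one: "scale_fun (-1) f = - f"
  by (simp add: scale_fun_def fun_eq_iff)

lemma ell2_uminus: "f \<in> ell2 A \<Longrightarrow> - f \<in> ell2 A"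
  using ell2_scale[of f A "-1"] by (simp add: scale_fun_minus_one)

lemma ell2_norm_uminus [simp]: "ell2_norm A (- f) = ell2_norm A f"
  using ell2_norm_scale[of A "-1" f] by (simp add: scale_fun_minus_one)

lemma ell2_add:
  assumes "f \<in> ell2 A" "g \<in> ell2 A"
  shows "f + g \<in> ell2 A"
  using ell2_diff[OF assms(1) ell2_uminus[OF assms(2)]] by simp

lemma ell2_norm_add_le:
  assumes "f \<in> ell2 A" "g \<in> ell2 A"
  shows "ell2_norm A (f + g) \<le> ell2_norm A f + ell2_norm A g"
  using ell2_norm_diff_le[OF assms(1) ell2_uminus[OF assms(2)]] by simp

lemma ell2_norm_diff_triangle:
  assumes "f \<in> ell2 A" "g \<in> ell2 A" "h \<in> ell2 A"
  shows "ell2_norm A (f - h) \<le> ell2_norm A (f - g) + ell2_norm A (g - h)"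
  using ell2_norm_add_le[OF ell2_diff[OF assms(1,2)] ell2_diff[OF assms(2,3)]] by simp

lemma ell2_norm_power2: "(ell2_norm A f)\<^sup>2 = (\<Sum>\<^sub>\<infinity>x\<in>A. (cmod (f x))\<^sup>2)"
  by (simp add: ell2_norm_def infsum_nonneg)

lemma sum_le_ell2_norm_power2:
  assumes "f \<in> ell2 A" "finite F" "F \<subseteq> A"
  shows "(\<Sum>x\<in>F. (cmod (f x))\<^sup>2) \<le> (ell2_norm A f)\<^sup>2"
  unfolding ell2_norm_power2 by (rule finite_sum_le_infsum) (use assms ell2_summable in auto)

lemma ell2_ket_norm:
  assumes "a \<in> A"
  shows ell2_ket: "ket a \<in> ell2 A" and ell2_norm_ket: "ell2_norm A (ket a) = 1"
proof -
  have *: "((\<lambda>x. (cmod (ket a x))\<^sup>2) has_sum 1) A"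
    using has_sum_finite_neutralI[of "{a}" A "\<lambda>x. (cmod (ket a x))\<^sup>2" 1] assms by (simp add: ket_def)
  then show "ket a \<in> ell2 A"
    using assms by (auto simp: ell2_def ket_def dest: has_sum_imp_summable)
  show "ell2_norm A (ket a) = 1"
    using infsumI[OF *] by (simp add: ell2_norm_def)
qed

text \<open>The squared error of truncating to F is the sum over A - F, that is, the total minus the
  sum over F, which becomes small by the definition of an infinite sum.\<close>

lemma ell2_approx_finite:
  assumes f: "f \<in> ell2 A" and e: "e > 0"
  obtains F where "finite F" "F \<subseteq> A" "ell2_norm A (f - (\<lambda>x. if x \<in> F then f x else 0)) < e"
proof -
  let ?g = "\<lambda>x. (cmod (f x))\<^sup>2"
  have "(?g has_sum infsum ?g A) A"
    using ell2_summable[OF f] by (rule has_sum_infsum)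
  then obtain F where F: "finite F" "F \<subseteq> A" "dist (sum ?g F) (infsum ?g A) < e\<^sup>2"
    using e tendstoD[of "sum ?g" _ "finite_subsets_at_top A" "e\<^sup>2"]
    unfolding has_sum_def eventually_finite_subsets_at_top by (metis subset_refl zero_less_power)
  have "(\<Sum>\<^sub>\<infinity>x\<in>A. (cmod ((f - (\<lambda>x. if x \<in> F then f x else 0)) x))\<^sup>2) = infsum ?g (A - F)"
    by (rule infsum_cong_neutral) auto
  also have "\<dots> = infsum ?g A - infsum ?g F"
    by (rule infsum_Diff) (use F ell2_summable[OF f] in auto)
  also have "\<dots> < e\<^sup>2"
    using F by (simp add: dist_real_def)
  finally have "ell2_norm A (f - (\<lambda>x. if x \<in> F then f x else 0)) < e"
    unfolding ell2_norm_def using e by (simp add: real_less_lsqrt)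
  with F that show ?thesis by blast
qed

section \<open>Closed subspaces\<close>

definition closed_subspace :: "'a set \<Rightarrow> ('a \<Rightarrow> complex) set \<Rightarrow> bool" where
  "closed_subspace A N \<longleftrightarrow> N \<subseteq> ell2 A \<and> complex_fun.subspace N \<and>
     (\<forall>g\<in>ell2 A. (\<forall>e>0. \<exists>y\<in>N. ell2_norm A (g - y) < e) \<longrightarrow> g \<in> N)"

lemma closed_subspaceI:
  assumes "N \<subseteq> ell2 A" "0 \<in> N" "\<And>f g. f \<in> N \<Longrightarrow> g \<in> N \<Longrightarrow> f + g \<in> N"
    "\<And>c f. f \<in> N \<Longrightarrow> scale_fun c f \<in> N"
    "\<And>g. g \<in> ell2 A \<Longrightarrow> (\<And>e. e > 0 \<Longrightarrow> \<exists>y\<in>N. ell2_norm A (g - y) < e) \<Longrightarrow> g \<in> N"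
  shows "closed_subspace A N"
  using assms unfolding closed_subspace_def complex_fun.subspace_def by blast

lemma closed_subspaceD:
  assumes "closed_subspace A N"
  shows "N \<subseteq> ell2 A" "0 \<in> N" "f \<in> N \<Longrightarrow> g \<in> N \<Longrightarrow> f + g \<in> N" "f \<in> N \<Longrightarrow> scale_fun c f \<in> N"
    "f \<in> N \<Longrightarrow> g \<in> N \<Longrightarrow> f - g \<in> N"
    "g \<in> ell2 A \<Longrightarrow> (\<And>e. e > 0 \<Longrightarrow> \<exists>y\<in>N. ell2_norm A (g - y) < e) \<Longrightarrow> g \<in> N"
  using assms unfolding closed_subspace_def
  by (auto intro: complex_fun.subspace_0 complex_fun.subspace_add complex_fun.subspace_scale
      complex_fun.subspace_diff)

lemma closed_subspace_scale_iff:
  assumes "closed_subspace A N" "c \<noteq> 0"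
  shows "scale_fun c f \<in> N \<longleftrightarrow> f \<in> N"
  using closed_subspaceD(4)[OF assms(1), of f c]
    closed_subspaceD(4)[OF assms(1), of "scale_fun c f" "inverse c"] assms(2)
  by (auto simp: complex_fun.scale_left_imp_eq)

text \<open>Finitely supported vectors are dense. Every density claim below is reduced to basis
  vectors through this criterion.\<close>

lemma closed_subspace_eq_ell2:
  assumes N: "closed_subspace A N" and ket: "\<And>a. a \<in> A \<Longrightarrow> ket a \<in> N"
  shows "N = ell2 A"
proof
  show "ell2 A \<subseteq> N"
  proof
    fix f assume f: "f \<in> ell2 A"
    have *: "(\<lambda>x. if x \<in> F then f x else 0) \<in> N" if "finite F" "F \<subseteq> A" for F
      using that
    proof (induction F rule: finite_induct)
      case empty
      then show ?case using closed_subspaceD(2)[OF N] by (simp add: zero_fun_def)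
    next
      case (insert a F)
      have "(\<lambda>x. if x \<in> insert a F then f x else 0)
          = (\<lambda>x. if x \<in> F then f x else 0) + scale_fun (f a) (ket a)"
        using insert by (auto simp: fun_eq_iff scale_fun_def ket_def)
      then show ?case
        using insert ket closed_subspaceD(3,4)[OF N] by auto
    qed
    show "f \<in> N"
      by (rule closed_subspaceD(6)[OF N f]) (use * ell2_approx_finite[OF f] in metis)
  qed
qed (use closed_subspaceD(1)[OF N] in blast)

section \<open>Bounded linear maps between two such spaces\<close>

definition ell2_maps :: "'a set \<Rightarrow> 'b set \<Rightarrow> (('a \<Rightarrow> complex) \<Rightarrow> ('b \<Rightarrow> complex)) set" where
  "ell2_maps A B = {T.
     (\<forall>f\<in>ell2 A. T f \<in> ell2 B) \<and>
     (\<forall>f\<in>ell2 A. \<forall>g\<in>ell2 A. T (f + g) = T f + T g) \<and>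
     (\<forall>c. \<forall>f\<in>ell2 A. T (scale_fun c f) = scale_fun c (T f)) \<and>
     (\<exists>M. \<forall>f\<in>ell2 A. ell2_norm B (T f) \<le> M * ell2_norm A f)}"

lemma bounded_operators_eq: "bounded_operators A = ell2_maps A A"
  by (simp add: bounded_operators_def ell2_maps_def)

lemma ell2_mapsD:
  assumes "T \<in> ell2_maps A B"
  shows "f \<in> ell2 A \<Longrightarrow> T f \<in> ell2 B"
    "f \<in> ell2 A \<Longrightarrow> g \<in> ell2 A \<Longrightarrow> T (f + g) = T f + T g"
    "f \<in> ell2 A \<Longrightarrow> T (scale_fun c f) = scale_fun c (T f)"
  using assms by (auto simp: ell2_maps_def)

lemma ell2_maps_bound:
  assumes "T \<in> ell2_maps A B"
  obtains M where "M > 0" "\<And>f. f \<in> ell2 A \<Longrightarrow> ell2_norm B (T f) \<le> M * ell2_norm A f"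
proof -
  obtain M where M: "\<forall>f\<in>ell2 A. ell2_norm B (T f) \<le> M * ell2_norm A f"
    using assms by (auto simp: ell2_maps_def)
  \<comment> \<open>The added 1 makes the bound strictly positive, so that
    \<open>closed_subspace_vimage\<close> can divide by it.\<close>
  have "ell2_norm B (T f) \<le> (\<bar>M\<bar> + 1) * ell2_norm A f" if "f \<in> ell2 A" for f
    using M that by (smt (verit) ell2_norm_nonneg mult_right_mono)
  then show ?thesis using that[of "\<bar>M\<bar> + 1"] by simp
qed

lemma ell2_maps_diff:
  assumes T: "T \<in> ell2_maps A B" and "f \<in> ell2 A" "g \<in> ell2 A"
  shows "T (f - g) = T f - T g"
  using ell2_mapsD(2)[OF T assms(2) ell2_scale[OF assms(3)], of "-1"]
    ell2_mapsD(3)[OF T assms(3), of "-1"] by simp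

lemma ell2_maps_zero: "T \<in> ell2_maps A B \<Longrightarrow> T 0 = 0"
  using ell2_maps_diff[of T A B 0 0] by simp

lemma ell2_maps_comp:
  assumes T: "T \<in> ell2_maps A B" and T': "T' \<in> ell2_maps B C"
  shows "(\<lambda>f. T' (T f)) \<in> ell2_maps A C"
proof -
  obtain M where M: "M > 0" "\<And>f. f \<in> ell2 A \<Longrightarrow> ell2_norm B (T f) \<le> M * ell2_norm A f"
    using ell2_maps_bound[OF T] by blast
  obtain M' where M': "M' > 0" "\<And>f. f \<in> ell2 B \<Longrightarrow> ell2_norm C (T' f) \<le> M' * ell2_norm B f"
    using ell2_maps_bound[OF T'] by blast
  have "ell2_norm C (T' (T f)) \<le> (M' * M) * ell2_norm A f" if "f \<in> ell2 A" for f
  proof -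
    have "ell2_norm C (T' (T f)) \<le> M' * ell2_norm B (T f)"
      using M' that ell2_mapsD(1)[OF T] by blast
    also have "\<dots> \<le> M' * (M * ell2_norm A f)"
      using M M' that by (intro mult_left_mono) auto
    finally show ?thesis by simp
  qed
  then show ?thesis
    using ell2_mapsD[OF T] ell2_mapsD[OF T'] unfolding ell2_maps_def by auto
qed

lemma ell2_maps_power: "T \<in> ell2_maps A A \<Longrightarrow> (T ^^ n) \<in> ell2_maps A A"
proof (induction n)
  case 0
  show ?case by (auto simp: ell2_maps_def intro!: exI[of _ 1])
next
  case (Suc n)
  then show ?case
    using ell2_maps_comp[of "T ^^ n" A A T A] by (simp add: comp_def)
qed

lemma ell2_maps_add:
  assumes T: "T \<in> ell2_maps A B" and T': "T' \<in> ell2_maps A B"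
  shows "(\<lambda>f. T f + T' f) \<in> ell2_maps A B"
proof -
  obtain M where M: "M > 0" "\<And>f. f \<in> ell2 A \<Longrightarrow> ell2_norm B (T f) \<le> M * ell2_norm A f"
    using ell2_maps_bound[OF T] by blast
  obtain M' where M': "M' > 0" "\<And>f. f \<in> ell2 A \<Longrightarrow> ell2_norm B (T' f) \<le> M' * ell2_norm A f"
    using ell2_maps_bound[OF T'] by blast
  have "ell2_norm B (T f + T' f) \<le> (M + M') * ell2_norm A f" if "f \<in> ell2 A" for f
    using ell2_norm_add_le[OF ell2_mapsD(1)[OF T that] ell2_mapsD(1)[OF T' that]] M(2)[OF that] M'(2)[OF that]
    by (simp add: algebra_simps)
  then show ?thesis
    using ell2_mapsD[OF T] ell2_mapsD[OF T'] unfolding ell2_maps_def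
    by (auto simp: ell2_add complex_fun.scale_right_distrib)
qed

lemma ell2_maps_minus:
  assumes T: "T \<in> ell2_maps A B"
  shows "(\<lambda>f. - T f) \<in> ell2_maps A B"
  using assms unfolding ell2_maps_def by (auto simp: ell2_uminus)

text \<open>Injectivity of \<open>p\<close> on \<open>C\<close> means that each coordinate of
  \<open>f\<close> is used at most once, so the norm grows by at most the factor |M|. Restriction to
  the trunk, diagonal operators, unbranched shifts and the summands of the lift and of the adjoint
  all have this shape.\<close>

lemma ell2_maps_weighted:
  fixes m :: "'b \<Rightarrow> complex"
  assumes C: "C \<subseteq> B" and inj: "inj_on p C" and p: "p ` C \<subseteq> A"
    and m: "\<And>v. v \<in> C \<Longrightarrow> cmod (m v) \<le> M"
  shows "(\<lambda>f v. if v \<in> C then m v * f (p v) else 0) \<in> ell2_maps A B" (is "?T \<in> _")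
proof -
  have bd: "(\<Sum>x\<in>F. (cmod (?T f x))\<^sup>2) \<le> (\<bar>M\<bar> * ell2_norm A f)\<^sup>2"
    if f: "f \<in> ell2 A" and F: "finite F" "F \<subseteq> B" for f F
  proof -
    have "(\<Sum>x\<in>F. (cmod (?T f x))\<^sup>2) = (\<Sum>x\<in>F \<inter> C. (cmod (m x * f (p x)))\<^sup>2)"
      using F by (intro sum.mono_neutral_cong_right) auto
    also have "\<dots> \<le> (\<Sum>x\<in>F \<inter> C. M\<^sup>2 * (cmod (f (p x)))\<^sup>2)"
      using m by (intro sum_mono) (auto simp: norm_mult power_mult_distrib intro!: mult_right_mono power_mono)
    also have "\<dots> = M\<^sup>2 * (\<Sum>y\<in>p ` (F \<inter> C). (cmod (f y))\<^sup>2)"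
      using inj by (subst sum.reindex) (auto simp: sum_distrib_left intro: inj_on_subset)
    also have "\<dots> \<le> M\<^sup>2 * (ell2_norm A f)\<^sup>2"
      using F p by (intro mult_left_mono sum_le_ell2_norm_power2 f) auto
    finally show ?thesis by (simp add: power_mult_distrib)
  qed
  have *: "0 \<le> \<bar>M\<bar> * ell2_norm A f" for f by simp
  have "?T f \<in> ell2 B" "ell2_norm B (?T f) \<le> \<bar>M\<bar> * ell2_norm A f" if "f \<in> ell2 A" for f
    by (rule ell2I_bounded[OF _ *[of f] bd[OF that]]; use C in auto)+
  then show ?thesis
    unfolding ell2_maps_def
    by (auto simp: scale_fun_def fun_eq_iff algebra_simps intro!: exI[of _ "\<bar>M\<bar>"])
qed

text \<open>This is the form in which continuity enters: a closed subspace is pulled back along a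
  bounded map, and cyclicity is then applied to the preimage.\<close>

lemma closed_subspace_vimage:
  assumes T: "T \<in> ell2_maps A B" and N: "closed_subspace B N"
  shows "closed_subspace A {g \<in> ell2 A. T g \<in> N}" (is "closed_subspace A ?D")
proof (rule closed_subspaceI)
  fix g assume g: "g \<in> ell2 A" and ap: "\<And>e. e > 0 \<Longrightarrow> \<exists>y\<in>?D. ell2_norm A (g - y) < e"
  obtain M where M: "M > 0" "\<And>f. f \<in> ell2 A \<Longrightarrow> ell2_norm B (T f) \<le> M * ell2_norm A f"
    using ell2_maps_bound[OF T] by blast
  have "T g \<in> N"
  proof (rule closed_subspaceD(6)[OF N])
    fix e :: real assume "e > 0"
    then obtain y where y: "y \<in> ?D" "ell2_norm A (g - y) < e / M"
      using ap[of "e / M"] M by auto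
    have "ell2_norm B (T g - T y) \<le> M * ell2_norm A (g - y)"
      using M(2)[OF ell2_diff[OF g]] y g by (simp add: ell2_maps_diff[OF T])
    also have "\<dots> < e"
      using y M by (simp add: field_simps)
    finally show "\<exists>z\<in>N. ell2_norm B (T g - z) < e"
      using y by blast
  qed (use g ell2_mapsD[OF T] in auto)
  then show "g \<in> ?D" using g by simp
qed (use ell2_mapsD[OF T] closed_subspaceD[OF N] ell2_maps_zero[OF T] in
    \<open>auto simp: ell2_add ell2_scale\<close>)

lemma closed_subspace_zero: "closed_subspace A {0}"
proof (rule closed_subspaceI)
  fix g assume g: "g \<in> ell2 A" and "\<And>e. e > 0 \<Longrightarrow> \<exists>y\<in>{0}. ell2_norm A (g - y) < e"
  then have "ell2_norm A g < e" if "e > 0" for e using that by simp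
  then have "ell2_norm A g = 0"
    by (metis ell2_norm_nonneg less_irrefl order_le_less)
  then show "g \<in> {0}" using ell2_norm_eq_0_iff[OF g] by simp
qed (auto simp: scale_fun_def fun_eq_iff)

text \<open>The kernel of T - T' is a closed subspace that contains the basis.\<close>

lemma ell2_maps_eqI:
  assumes T: "T \<in> ell2_maps A B" and T': "T' \<in> ell2_maps A B"
    and ket: "\<And>a. a \<in> A \<Longrightarrow> T (ket a) = T' (ket a)" and f: "f \<in> ell2 A"
  shows "T f = T' f"
proof -
  have "(\<lambda>f. T f + - T' f) \<in> ell2_maps A B"
    by (intro ell2_maps_add ell2_maps_minus T T')
  from closed_subspace_vimage[OF this closed_subspace_zero]
  have "{g \<in> ell2 A. T g + - T' g \<in> {0}} = ell2 A"
    by (rule closed_subspace_eq_ell2) (simp add: ket ell2_ket)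
  then show ?thesis using f by auto
qed

section \<open>Cyclicity in terms of closed subspaces\<close>

lemma closed_subspace_closure_of:
  assumes U: "U \<subseteq> ell2 A" "complex_fun.subspace U"
  shows "closed_subspace A (ell2.mtopology A closure_of U)"
proof -
  have cl: "g \<in> ell2.mtopology A closure_of U \<longleftrightarrow>
      g \<in> ell2 A \<and> (\<forall>e>0. \<exists>y\<in>U. ell2_norm A (g - y) < e)" for g
    using U by (auto simp: ell2.metric_closure_of ell2.in_mball ell2_dist_def) blast
  show ?thesis
  proof (rule closed_subspaceI)
    show "0 \<in> ell2.mtopology A closure_of U"
      using U(2) by (auto simp: cl intro!: bexI[of _ 0] complex_fun.subspace_0)
  next
    fix f g assume fg: "f \<in> ell2.mtopology A closure_of U" "g \<in> ell2.mtopology A closure_of U"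
    have "\<exists>y\<in>U. ell2_norm A (f + g - y) < e" if e: "e > 0" for e
    proof -
      obtain y z where yz: "y \<in> U" "z \<in> U" "ell2_norm A (f - y) < e / 2" "ell2_norm A (g - z) < e / 2"
        using fg e unfolding cl by (metis half_gt_zero)
      have "ell2_norm A ((f - y) + (g - z)) \<le> ell2_norm A (f - y) + ell2_norm A (g - z)"
        using fg yz U by (intro ell2_norm_add_le ell2_diff) (auto simp: cl)
      then have "ell2_norm A (f + g - (y + z)) < e"
        using yz by (simp add: algebra_simps)
      then show ?thesis
        using yz U by (blast intro: complex_fun.subspace_add)
    qed
    then show "f + g \<in> ell2.mtopology A closure_of U"
      using fg by (auto simp: cl ell2_add)
  next
    fix c f assume f: "f \<in> ell2.mtopology A closure_of U"
    have "\<exists>y\<in>U. ell2_norm A (scale_fun c f - y) < e" if e: "e > 0" for e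
    proof -
      obtain y where y: "y \<in> U" "ell2_norm A (f - y) < e / (cmod c + 1)"
        using f e unfolding cl by (metis add_nonneg_pos divide_pos_pos norm_ge_zero zero_less_one)
      have "ell2_norm A (scale_fun c f - scale_fun c y) = cmod c * ell2_norm A (f - y)"
        by (simp add: complex_fun.scale_right_diff_distrib[symmetric] ell2_norm_scale)
      also have "\<dots> \<le> (cmod c + 1) * ell2_norm A (f - y)"
        by (intro mult_right_mono) auto
      also have "\<dots> < e"
        using y by (simp add: field_simps add_pos_nonneg)
      finally show ?thesis
        using y U by (blast intro: complex_fun.subspace_scale)
    qed
    then show "scale_fun c f \<in> ell2.mtopology A closure_of U"
      using f by (auto simp: cl ell2_scale)
  next
    fix g assume g: "g \<in> ell2 A"
      and ap: "\<And>e. e > 0 \<Longrightarrow> \<exists>y\<in>ell2.mtopology A closure_of U. ell2_norm A (g - y) < e"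
    have "\<exists>y\<in>U. ell2_norm A (g - y) < e" if e: "e > 0" for e
    proof -
      obtain y where y: "y \<in> ell2.mtopology A closure_of U" "ell2_norm A (g - y) < e / 2"
        using ap[of "e / 2"] e by auto
      then obtain z where z: "z \<in> U" "ell2_norm A (y - z) < e / 2"
        using e unfolding cl by (metis half_gt_zero)
      have "ell2_norm A (g - z) \<le> ell2_norm A (g - y) + ell2_norm A (y - z)"
        using g y z U by (intro ell2_norm_diff_triangle) (auto simp: cl)
      then show ?thesis using y z by (intro bexI[of _ z]) auto
    qed
    then show "g \<in> ell2.mtopology A closure_of U" using g by (auto simp: cl)
  qed (auto simp: cl)
qed

text \<open>The closed linear span of the orbit is the smallest closed subspace containing it, so h
  is cyclic exactly when its orbit lies in no proper closed subspace. All later arguments use this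
  form instead of the topological closure.\<close>

lemma cyclic_iff_closed_subspace:
  assumes T: "T \<in> ell2_maps A A"
  shows "cyclic A T \<longleftrightarrow>
    (\<exists>h\<in>ell2 A. \<forall>N. closed_subspace A N \<longrightarrow> (\<forall>n. (T ^^ n) h \<in> N) \<longrightarrow> N = ell2 A)"
  unfolding cyclic_def
proof (rule bex_cong[OF refl])
  fix h assume h: "h \<in> ell2 A"
  let ?U = "complex_fun.span {(T ^^ n) h |n. True}"
  have orb: "{(T ^^ n) h |n. True} \<subseteq> ell2 A"
    using ell2_mapsD(1)[OF ell2_maps_power[OF T] h] by auto
  have "complex_fun.subspace (ell2 A)"
    by (auto simp: complex_fun.subspace_def ell2_add ell2_scale)
  with orb have U: "?U \<subseteq> ell2 A"
    by (rule complex_fun.span_minimal)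
  show "(ell2.mtopology A closure_of ?U = ell2 A) \<longleftrightarrow>
    (\<forall>N. closed_subspace A N \<longrightarrow> (\<forall>n. (T ^^ n) h \<in> N) \<longrightarrow> N = ell2 A)"
  proof safe
    fix N f assume cl: "ell2.mtopology A closure_of ?U = ell2 A"
      and N: "closed_subspace A N" "\<forall>n. (T ^^ n) h \<in> N" and f: "f \<in> ell2 A"
    have UN: "?U \<subseteq> N"
      by (rule complex_fun.span_minimal) (use N in \<open>auto simp: closed_subspace_def\<close>)
    show "f \<in> N"
    proof (rule closed_subspaceD(6)[OF N(1) f])
      fix e :: real assume "e > 0"
      then show "\<exists>y\<in>N. ell2_norm A (f - y) < e"
        using cl f UN by (auto simp: ell2.metric_closure_of ell2.in_mball ell2_dist_def) blast
    qed
  next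
    fix f assume min: "\<forall>N. closed_subspace A N \<longrightarrow> (\<forall>n. (T ^^ n) h \<in> N) \<longrightarrow> N = ell2 A"
    have "?U \<subseteq> ell2.mtopology A closure_of ?U"
      using U by (intro closure_of_subset) simp
    then have "ell2.mtopology A closure_of ?U = ell2 A"
      using min closed_subspace_closure_of[OF U complex_fun.subspace_span]
      by (metis (mono_tags, lifting) complex_fun.span_base mem_Collect_eq subsetD)
    then show "f \<in> ell2.mtopology A closure_of ?U \<Longrightarrow> f \<in> ell2 A"
      "f \<in> ell2 A \<Longrightarrow> f \<in> ell2.mtopology A closure_of ?U" by auto
  qed (use closed_subspaceD(1) in blast)
qed

lemma intertwining_power:
  assumes T: "T \<in> ell2_maps A A" and X: "\<And>f. f \<in> ell2 A \<Longrightarrow> X (T f) = T' (X f)" and f: "f \<in> ell2 A"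
  shows "X ((T ^^ n) f) = (T' ^^ n) (X f)"
  by (induction n) (use X ell2_mapsD(1)[OF ell2_maps_power[OF T] f] in auto)

text \<open>X maps a cyclic vector h to a cyclic vector: if N contains the orbit of X h, then its
  preimage contains the orbit of h and hence is everything, so N contains the range of X and with it
  the basis.\<close>

lemma cyclic_intertwining:
  assumes T: "T \<in> ell2_maps A A" and T': "T' \<in> ell2_maps B B" and X: "X \<in> ell2_maps A B"
    and XT: "\<And>f. f \<in> ell2 A \<Longrightarrow> X (T f) = T' (X f)"
    and ket: "\<And>b. b \<in> B \<Longrightarrow> ket b \<in> X ` ell2 A" and cyc: "cyclic A T"
  shows "cyclic B T'"
proof -
  obtain h where h: "h \<in> ell2 A"
    and min: "\<And>N. closed_subspace A N \<Longrightarrow> (\<And>n. (T ^^ n) h \<in> N) \<Longrightarrow> N = ell2 A"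
    using cyc unfolding cyclic_iff_closed_subspace[OF T] by blast
  show ?thesis
    unfolding cyclic_iff_closed_subspace[OF T']
  proof (intro bexI[of _ "X h"] allI impI)
    fix N assume N: "closed_subspace B N" "\<forall>n. (T' ^^ n) (X h) \<in> N"
    have "{g \<in> ell2 A. X g \<in> N} = ell2 A"
    proof (rule min[OF closed_subspace_vimage[OF X N(1)]])
      show "(T ^^ n) h \<in> {g \<in> ell2 A. X g \<in> N}" for n
        using N(2) intertwining_power[where X = X and T = T and T' = T', OF T XT h] ell2_mapsD(1)[OF ell2_maps_power[OF T] h] by simp
    qed
    then show "N = ell2 B"
      using closed_subspace_eq_ell2[OF N(1)] ket by (force simp: set_eq_iff image_iff)
  qed (use ell2_mapsD(1)[OF X h] in auto)
qed

section \<open>The shift on the tree and its trunk\<close>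

definition parent :: "vertex \<Rightarrow> vertex" where
  "parent v = (case v of Trunk k \<Rightarrow> Trunk (k - 1)
    | Branch k \<Rightarrow> if k = 1 then Trunk 0 else Branch (k - 1))"

lemma parent_simps [simp]:
  "parent (Trunk k) = Trunk (k - 1)" "parent (Branch (Suc 0)) = Trunk 0"
  "j \<noteq> 1 \<Longrightarrow> parent (Branch j) = Branch (j - 1)"
  by (auto simp: parent_def)

lemma Trunk_in_tree_V [simp]: "Trunk k \<in> tree_V k0"
  by (simp add: tree_V_def)

lemma Branch_in_tree_V [simp]: "Branch j \<in> tree_V k0 \<longleftrightarrow> 1 \<le> j \<and> j \<le> k0"
  by (auto simp: tree_V_def)

lemma parent_in_tree_V: "v \<in> tree_V k0 \<Longrightarrow> parent v \<in> tree_V k0"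
  by (cases v) (auto simp: parent_def)

text \<open>Trunk and branch are treated separately because \<open>Trunk 1\<close> and
  \<open>Branch 1\<close> share the parent \<open>Trunk 0\<close>.\<close>

lemma inj_on_parent: "inj_on parent (range Trunk)" "inj_on parent (Branch ` {1..k0})"
  by (auto simp: inj_on_def parent_def split: if_splits)

text \<open>The definition prescribes S on basis vectors only. There it agrees with the weighted
  composition, since v is a child of u exactly when its parent is u, and boundedness extends the
  agreement to all of \<open>ell2\<close>.\<close>

lemma is_weighted_shift_apply:
  assumes k0: "k0 \<ge> 1" and bd: "bounded (lam ` tree_V k0)"
    and S: "is_weighted_shift (tree_V k0) (tree_E k0) lam S" and f: "f \<in> ell2 (tree_V k0)"
  shows "S f = (\<lambda>v. if v \<in> tree_V k0 then complex_of_real (lam v) * f (parent v) else 0)"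
proof -
  let ?T = "\<lambda>f v. if v \<in> tree_V k0 then complex_of_real (lam v) * f (parent v) else 0"
  obtain M where M: "\<And>v. v \<in> tree_V k0 \<Longrightarrow> \<bar>lam v\<bar> \<le> M"
    using bd by (auto simp: bounded_iff)
  have T: "?T \<in> bounded_operators (tree_V k0)"
    by (rule weighted_composition_bounded[OF tree_V_def inj_on_parent])
      (use M parent_in_tree_V in auto)
  have "S (ket u) = ?T (ket u)" if "u \<in> tree_V k0" for u
  proof -
    have chi: "v \<in> Chi (tree_V k0) (tree_E k0) u \<longleftrightarrow> v \<in> tree_V k0 \<and> parent v = u" for v
      using k0 by (cases v; cases u) (auto simp: Chi_def tree_V_def tree_E_def parent_def)
    have "Chi (tree_V k0) (tree_E k0) u \<subseteq>
        (case u of Trunk k \<Rightarrow> {Trunk (k + 1), Branch 1} | Branch k \<Rightarrow> {Branch (k + 1)})"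
      by (auto simp: Chi_def tree_E_def)
    then have fin: "finite (Chi (tree_V k0) (tree_E k0) u)"
      by (rule finite_subset) (auto split: vertex.split)
    have "(\<Sum>v\<in>Chi (tree_V k0) (tree_E k0) u. scale_fun (complex_of_real (lam v)) (ket v)) w = ?T (ket u) w" for w
    proof -
      have "(\<Sum>v\<in>Chi (tree_V k0) (tree_E k0) u. scale_fun (complex_of_real (lam v)) (ket v)) w
          = (\<Sum>v\<in>Chi (tree_V k0) (tree_E k0) u. scale_fun (complex_of_real (lam v)) (ket v) w)"
        using fin by (induction rule: finite_induct) auto
      also have "\<dots> = (\<Sum>v\<in>Chi (tree_V k0) (tree_E k0) u. if w = v then complex_of_real (lam v) else 0)"
        by (intro sum.cong) (auto simp: scale_fun_def ket_def)
      also have "\<dots> = ?T (ket u) w"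
        using fin chi[of w] by (auto simp: ket_def)
      finally show ?thesis .
    qed
    then show ?thesis
      using S that by (simp add: is_weighted_shift_def fun_eq_iff)
  qed
  moreover have "S \<in> ell2_maps (tree_V k0) (tree_V k0)"
    using S by (simp add: is_weighted_shift_def bounded_operators_eq)
  ultimately show ?thesis
    using ell2_maps_eqI[OF _ T[unfolded bounded_operators_eq] _ f] by blast
qed

lemma is_bilateral_shift_apply:
  assumes bd: "bounded (range w)" and W: "is_bilateral_shift w W" and f: "f \<in> ell2 UNIV"
  shows "W f = (\<lambda>k. complex_of_real (w k) * f (k - 1))"
proof -
  \<comment> \<open>The vacuous condition \<open>k \<in> UNIV\<close> gives the map the shape that
    \<open>ell2_maps_weighted\<close> expects.\<close>
  let ?T = "\<lambda>(f :: int \<Rightarrow> complex) k. if k \<in> UNIV then complex_of_real (w k) * f (k - 1) else 0"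
  obtain M where M: "\<And>k. \<bar>w k\<bar> \<le> M"
    using bd by (auto simp: bounded_iff)
  have T: "?T \<in> ell2_maps UNIV UNIV"
    by (rule ell2_maps_weighted[where M = M]) (use M in \<open>auto simp: inj_on_def\<close>)
  have "W (ket k) = ?T (ket k)" for k
    using W by (auto simp: is_bilateral_shift_def fun_eq_iff scale_fun_def ket_def)
  then show ?thesis
    using ell2_maps_eqI[of W UNIV UNIV ?T f] W T f
    by (simp add: is_bilateral_shift_def bounded_operators_eq)
qed

text \<open>The weight of the diagonal operator that carries the unweighted shift to the shift with
  weights \<open>w\<close>, normalised to be \<open>1\<close> at \<open>0\<close>.\<close>

definition cumprod :: "(int \<Rightarrow> real) \<Rightarrow> int \<Rightarrow> real" where
  "cumprod w k = (if k \<ge> 0 then \<Prod>j\<in>{1..k}. w j else 1 / (\<Prod>j\<in>{k + 1..0}. w j))"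

lemma cumprod_pos:
  assumes "\<And>k. w k > 0"
  shows "cumprod w k > 0"
  using assms by (simp add: cumprod_def prod_pos)

text \<open>The recursion passes through 0 without a break because the reciprocal product used for
  negative k extends up to and including the index 0.\<close>

lemma cumprod_step:
  assumes "\<And>k. w k > 0"
  shows "cumprod w k = w k * cumprod w (k - 1)"
proof -
  have nz: "(\<Prod>j\<in>X. w j) \<noteq> 0" for X
    using prod_pos[of X w] assms by (metis less_irrefl)
  consider "k \<ge> 1" | "k = 0" | "k < 0" by linarith
  then show ?thesis
  proof cases
    case 1
    then have "{1..k} = insert k {1..k - 1}" by auto
    with 1 show ?thesis by (simp add: cumprod_def)
  next
    case 2
    then show ?thesis using assms[of 0] by (simp add: cumprod_def)
  next
    case 3
    then have "{k..0} = insert k {k + 1..0}" by auto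
    with 3 show ?thesis using assms[of k] nz by (simp add: cumprod_def)
  qed
qed

section \<open>Transfer of cyclicity between the tree and its trunk\<close>

locale tree_shift =
  fixes k0 :: nat and lam :: "vertex \<Rightarrow> real"
    and S :: "(vertex \<Rightarrow> complex) \<Rightarrow> (vertex \<Rightarrow> complex)"
    and W :: "(int \<Rightarrow> complex) \<Rightarrow> (int \<Rightarrow> complex)"
  assumes k0: "k0 \<ge> 1" and pos: "\<And>v. v \<in> tree_V k0 \<Longrightarrow> lam v > 0"
    and bounded: "bounded (lam ` tree_V k0)"
    and weighted_shift: "is_weighted_shift (tree_V k0) (tree_E k0) lam S"
    and bilateral_shift: "is_bilateral_shift (\<lambda>k. lam (Trunk k)) W"
begin

abbreviation V where "V \<equiv> tree_V k0"

lemma S_map: "S \<in> ell2_maps V V" and W_map: "W \<in> ell2_maps UNIV UNIV"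
  using weighted_shift bilateral_shift
  by (auto simp: is_weighted_shift_def is_bilateral_shift_def bounded_operators_eq)

lemma S_apply:
  "f \<in> ell2 V \<Longrightarrow> S f = (\<lambda>v. if v \<in> V then complex_of_real (lam v) * f (parent v) else 0)"
  by (rule is_weighted_shift_apply[OF k0 bounded weighted_shift])

lemma W_apply: "f \<in> ell2 UNIV \<Longrightarrow> W f = (\<lambda>k. complex_of_real (lam (Trunk k)) * f (k - 1))"
proof (rule is_bilateral_shift_apply[OF _ bilateral_shift])
  show "bounded (range (\<lambda>k. lam (Trunk k)))"
    by (rule bounded_subset[OF bounded]) auto
qed

definition trunk_restriction :: "(vertex \<Rightarrow> complex) \<Rightarrow> int \<Rightarrow> complex" where
  "trunk_restriction f k = f (Trunk k)"

lemma trunk_restriction_map: "trunk_restriction \<in> ell2_maps V UNIV"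
proof -
  have "(\<lambda>f v. if v \<in> UNIV then 1 * f (Trunk v) else 0) \<in> ell2_maps V UNIV"
    by (rule ell2_maps_weighted[where M = 1]) (auto simp: inj_on_def)
  then show ?thesis by (simp add: trunk_restriction_def[abs_def])
qed

text \<open>Parents of trunk vertices lie on the trunk, so the restriction to it intertwines S with
  W, and every basis vector of the line is the restriction of a basis vector of the tree.\<close>

lemma cyclic_bilateral:
  assumes "cyclic V S"
  shows "cyclic UNIV W"
proof (rule cyclic_intertwining[OF S_map W_map trunk_restriction_map _ _ assms])
  show "trunk_restriction (S f) = W (trunk_restriction f)" if "f \<in> ell2 V" for f
    using that ell2_mapsD(1)[OF trunk_restriction_map that]
    by (simp add: S_apply W_apply fun_eq_iff trunk_restriction_def)
  show "ket k \<in> trunk_restriction ` ell2 V" for k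
  proof
    show "ket k = trunk_restriction (ket (Trunk k))"
      by (auto simp: trunk_restriction_def ket_def fun_eq_iff)
  qed (simp add: ell2_ket)
qed

text \<open>This is the product of the weights on the way from \<open>Trunk 0\<close> to
  \<open>Branch j\<close>, divided by the product on the way from \<open>Trunk 0\<close> to
  \<open>Trunk j\<close>. The quotient makes \<open>trunk_lift\<close> intertwine W with S.\<close>

definition branch_coeff :: "nat \<Rightarrow> real" where
  "branch_coeff j = (\<Prod>i\<in>{1..j}. lam (Branch i)) / cumprod (\<lambda>k. lam (Trunk k)) (int j)"

text \<open>The range is an \<open>S\<close>-invariant complement of the branch, on which \<open>S\<close> acts as \<open>W\<close>.\<close>

definition trunk_lift :: "(int \<Rightarrow> complex) \<Rightarrow> vertex \<Rightarrow> complex" where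
  "trunk_lift f v = (case v of Trunk k \<Rightarrow> f k
    | Branch j \<Rightarrow> if v \<in> V then complex_of_real (branch_coeff j) * f (int j) else 0)"

lemma trunk_lift_map: "trunk_lift \<in> ell2_maps UNIV V"
proof -
  let ?p = "case_vertex id int"
  let ?c = "\<lambda>v. case v of Trunk k \<Rightarrow> 1 | Branch j \<Rightarrow> complex_of_real (branch_coeff j)"
  have "finite (branch_coeff ` {1..k0})" by simp
  then obtain M where M: "\<And>j. j \<in> {1..k0} \<Longrightarrow> \<bar>branch_coeff j\<bar> \<le> M"
    using finite_imp_bounded[of "branch_coeff ` {1..k0}"]
    unfolding bounded_iff real_norm_def by blast
  \<comment> \<open>A value of f at j with j between 1 and k0 appears both on the trunk and on the
    branch, so the lift is a sum of two maps whose index functions are injective.\<close>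
  have "(\<lambda>f. (\<lambda>v. if v \<in> range Trunk then ?c v * f (?p v) else 0)
      + (\<lambda>v. if v \<in> Branch ` {1..k0} then ?c v * f (?p v) else 0)) \<in> ell2_maps UNIV V"
  proof (intro ell2_maps_add)
    show "(\<lambda>f v. if v \<in> range Trunk then ?c v * f (?p v) else 0) \<in> ell2_maps UNIV V"
      by (rule ell2_maps_weighted[where M = 1]) (auto simp: inj_on_def)
    show "(\<lambda>f v. if v \<in> Branch ` {1..k0} then ?c v * f (?p v) else 0) \<in> ell2_maps UNIV V"
      by (rule ell2_maps_weighted[where M = M]) (use M in \<open>auto simp: inj_on_def\<close>)
  qed
  also have "(\<lambda>f. (\<lambda>v. if v \<in> range Trunk then ?c v * f (?p v) else 0)
      + (\<lambda>v. if v \<in> Branch ` {1..k0} then ?c v * f (?p v) else 0)) = trunk_lift"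
    by (auto simp: trunk_lift_def fun_eq_iff split: vertex.split)
  finally show ?thesis .
qed

lemma cumprod_trunk_pos: "cumprod (\<lambda>k. lam (Trunk k)) k > 0"
  by (rule cumprod_pos) (simp add: pos)

lemma branch_coeff_step:
  assumes "j \<ge> 1"
  shows "branch_coeff j * lam (Trunk (int j)) = lam (Branch j) * branch_coeff (j - 1)"
proof -
  have "{1..j} = insert j {1..j - 1}" using assms by auto
  then have "(\<Prod>i\<in>{1..j}. lam (Branch i)) = lam (Branch j) * (\<Prod>i\<in>{1..j - 1}. lam (Branch i))"
    using assms by simp
  moreover have "cumprod (\<lambda>k. lam (Trunk k)) (int j)
      = lam (Trunk (int j)) * cumprod (\<lambda>k. lam (Trunk k)) (int (j - 1))"
    using cumprod_step[of "\<lambda>k. lam (Trunk k)" "int j"] assms pos by (simp add: of_nat_diff)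
  moreover have "lam (Trunk (int j)) > 0" "cumprod (\<lambda>k. lam (Trunk k)) (int (j - 1)) > 0"
    by (simp_all add: pos cumprod_trunk_pos)
  ultimately show ?thesis
    by (simp add: branch_coeff_def)
qed

lemma trunk_lift_W:
  assumes f: "f \<in> ell2 UNIV"
  shows "trunk_lift (W f) = S (trunk_lift f)"
proof
  fix v
  show "trunk_lift (W f) v = S (trunk_lift f) v"
  proof (cases v)
    case (Trunk k)
    then show ?thesis
      using f by (simp add: S_apply[OF ell2_mapsD(1)[OF trunk_lift_map f]] W_apply[OF f] trunk_lift_def)
  next
    case (Branch j)
    show ?thesis
    proof (cases "v \<in> V")
      case False
      then show ?thesis using Branch
        by (auto simp: S_apply[OF ell2_mapsD(1)[OF trunk_lift_map f]] trunk_lift_def)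
    next
      case True
      \<comment> \<open>For j = 1 the parent is \<open>Trunk 0\<close>, and the formula persists
        because \<open>branch_coeff 0\<close> is 1.\<close>
      have "trunk_lift f (parent v) = complex_of_real (branch_coeff (j - 1)) * f (int j - 1)"
        using Branch True by (cases "j = 1") (auto simp: trunk_lift_def of_nat_diff branch_coeff_def cumprod_def)
      moreover have "complex_of_real (branch_coeff j) * complex_of_real (lam (Trunk (int j)))
          = complex_of_real (lam v) * complex_of_real (branch_coeff (j - 1))"
        using branch_coeff_step[of j] True Branch by (metis Branch_in_tree_V of_real_mult)
      ultimately show ?thesis using Branch True
        by (simp add: S_apply[OF ell2_mapsD(1)[OF trunk_lift_map f]] W_apply[OF f] trunk_lift_def mult.assoc)
    qed
  qed
qed

text \<open>Consequently the range of each power of W contains the basis and is dense.\<close>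

lemma W_power_ket: "\<exists>c. c \<noteq> 0 \<and> (W ^^ n) (ket (k - int n)) = scale_fun c (ket k)"
proof (induction n arbitrary: k)
  case 0
  have "ket k = scale_fun 1 (ket k)" by simp
  then show ?case by (metis funpow_0 diff_zero of_nat_0 zero_neq_one)
next
  case (Suc n)
  obtain c where c: "c \<noteq> 0" "(W ^^ n) (ket (k - 1 - int n)) = scale_fun c (ket (k - 1))"
    using Suc by blast
  have "W (scale_fun c (ket (k - 1))) = scale_fun (complex_of_real (lam (Trunk k)) * c) (ket k)"
    by (subst W_apply[OF ell2_scale[OF ell2_ket]]) (auto simp: fun_eq_iff scale_fun_def ket_def)
  moreover have "k - int (Suc n) = k - 1 - int n" by simp
  moreover have "complex_of_real (lam (Trunk k)) * c \<noteq> 0"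
    using c pos[of "Trunk k"] by auto
  ultimately show ?case using c by (metis comp_apply funpow.simps(2))
qed

lemma S_ket_Branch:
  assumes "1 \<le> j" "j \<le> k0"
  shows "S (ket (Branch j)) = (if j < k0 then scale_fun (complex_of_real (lam (Branch (Suc j)))) (ket (Branch (Suc j))) else 0)"
proof -
  have "ket (Branch j) \<in> ell2 V" using assms by (simp add: ell2_ket)
  then show ?thesis
    using assms by (auto simp: S_apply fun_eq_iff ket_def scale_fun_def parent_def split: vertex.splits)
qed

text \<open>Up to nonzero factors, the orbit of the first branch vector runs through the whole
  branch, so adding this one vector suffices to reach every branch vertex.\<close>

lemma S_power_ket_Branch:
  assumes "n < k0"
  shows "\<exists>c. c \<noteq> 0 \<and> (S ^^ n) (ket (Branch 1)) = scale_fun c (ket (Branch (Suc n)))"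
  using assms
proof (induction n)
  case 0
  have "ket (Branch 1) = scale_fun 1 (ket (Branch 1))" by simp
  then show ?case by (metis funpow_0 One_nat_def zero_neq_one)
next
  case (Suc n)
  then obtain c where c: "c \<noteq> 0" "(S ^^ n) (ket (Branch 1)) = scale_fun c (ket (Branch (Suc n)))"
    by auto
  let ?l = "complex_of_real (lam (Branch (Suc (Suc n))))"
  have "(S ^^ Suc n) (ket (Branch 1)) = scale_fun (c * ?l) (ket (Branch (Suc (Suc n))))"
    using Suc.prems c S_ket_Branch[of "Suc n"] by (simp add: ell2_mapsD(3)[OF S_map] ell2_ket)
  moreover have "c * ?l \<noteq> 0"
    using c pos[of "Branch (Suc (Suc n))"] Suc.prems by auto
  ultimately show ?case by blast
qed

lemma S_power_ket_Branch_zero: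
  assumes "n \<ge> k0"
  shows "(S ^^ n) (ket (Branch (Suc 0))) = 0"
  using assms
proof (induction n rule: dec_induct)
  case base
  obtain m where m: "k0 = Suc m" using k0 by (cases k0) auto
  obtain c where "(S ^^ m) (ket (Branch 1)) = scale_fun c (ket (Branch (Suc m)))"
    using S_power_ket_Branch[of m] m by auto
  then show ?case
    using S_ket_Branch[of k0] m by (simp add: ell2_mapsD(3)[OF S_map] ell2_ket)
next
  case (step n)
  then show ?case
    by (simp only: funpow.simps comp_apply ell2_maps_zero[OF S_map])
qed

text \<open>The powers \<open>S\<^sup>n\<close> with \<open>n \<ge> k0\<close> kill the branch component of \<open>trunk_lift f + ket (Branch 1)\<close>, and
  the vectors \<open>W\<^sup>n f\<close> with \<open>n \<ge> k0\<close> still span a dense subspace because \<open>W\<close> has dense range.\<close>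

lemma cyclic_tree:
  assumes "cyclic UNIV W"
  shows "cyclic V S"
proof -
  obtain f where f: "f \<in> ell2 UNIV"
    and min: "\<And>N. closed_subspace UNIV N \<Longrightarrow> (\<And>n. (W ^^ n) f \<in> N) \<Longrightarrow> N = ell2 UNIV"
    using assms unfolding cyclic_iff_closed_subspace[OF W_map] by blast
  let ?b = "ket (Branch 1)"
  have b: "?b \<in> ell2 V" using k0 by (simp add: ell2_ket)
  have lf: "trunk_lift f \<in> ell2 V" by (rule ell2_mapsD(1)[OF trunk_lift_map f])
  show ?thesis
    unfolding cyclic_iff_closed_subspace[OF S_map]
  proof (intro bexI[of _ "trunk_lift f + ?b"] allI impI)
    show "trunk_lift f + ?b \<in> ell2 V" by (rule ell2_add[OF lf b])
    fix N assume N: "closed_subspace V N" and orb: "\<forall>n. (S ^^ n) (trunk_lift f + ?b) \<in> N"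
    have Sn: "(S ^^ n) (trunk_lift f + ?b) = trunk_lift ((W ^^ n) f) + (S ^^ n) ?b" for n
      using intertwining_power[where X = trunk_lift and T = W and T' = S, OF W_map trunk_lift_W f]
        ell2_mapsD(2)[OF ell2_maps_power[OF S_map] lf b] by simp
    have Wn: "(W ^^ n) g \<in> ell2 UNIV" if "g \<in> ell2 UNIV" for n g
      by (rule ell2_mapsD(1)[OF ell2_maps_power[OF W_map] that])
    let ?D = "{g \<in> ell2 UNIV. trunk_lift g \<in> N}"
    have D: "closed_subspace UNIV ?D"
      by (rule closed_subspace_vimage[OF trunk_lift_map N])
    \<comment> \<open>Only the orbit of f from time k0 on is known to lie in \<open>?D\<close>, so
      cyclicity of f is applied to the preimage of \<open>?D\<close> under the power k0 of
      W.\<close>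
    have D': "{g \<in> ell2 UNIV. (W ^^ k0) g \<in> ?D} = ell2 UNIV"
    proof (rule min[OF closed_subspace_vimage[OF ell2_maps_power[OF W_map] D]])
      fix n
      have "trunk_lift ((W ^^ (k0 + n)) f) \<in> N"
        using orb[rule_format, of "k0 + n"] unfolding Sn by (simp add: S_power_ket_Branch_zero)
      then show "(W ^^ n) f \<in> {g \<in> ell2 UNIV. (W ^^ k0) g \<in> ?D}"
        using Wn f by (simp add: funpow_add)
    qed
    have "?D = ell2 UNIV"
    proof (rule closed_subspace_eq_ell2[OF D])
      fix k :: int
      obtain c where "c \<noteq> 0" "(W ^^ k0) (ket (k - int k0)) = scale_fun c (ket k)"
        using W_power_ket by blast
      moreover have "(W ^^ k0) (ket (k - int k0)) \<in> ?D"
        using D' ell2_ket[of "k - int k0" UNIV] by blast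
      ultimately show "ket k \<in> ?D"
        using closed_subspace_scale_iff[OF D, of c "ket k"] by simp
    qed
    then have lift: "trunk_lift g \<in> N" if "g \<in> ell2 UNIV" for g
      using that by blast
    have branch: "ket (Branch j) \<in> N" if j: "1 \<le> j" "j \<le> k0" for j
    proof -
      obtain n where n: "j = Suc n" "n < k0" using j by (cases j) auto
      obtain c where c: "c \<noteq> 0" "(S ^^ n) ?b = scale_fun c (ket (Branch j))"
        using S_power_ket_Branch n by blast
      \<comment> \<open>Now that N contains all lifts, subtracting one from the orbit isolates the
        branch part.\<close>
      have "(S ^^ n) (trunk_lift f + ?b) - trunk_lift ((W ^^ n) f) \<in> N"
        using closed_subspaceD(5)[OF N] orb lift Wn[OF f] by blast
      then have "scale_fun c (ket (Branch j)) \<in> N"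
        unfolding Sn c(2) by simp
      then show ?thesis using c closed_subspace_scale_iff[OF N] by blast
    qed
    show "N = ell2 V"
    proof (rule closed_subspace_eq_ell2[OF N])
      fix v assume v: "v \<in> V"
      show "ket v \<in> N"
      proof (cases v)
        case (Branch j)
        then show ?thesis using branch v by simp
      next
        case (Trunk k)
        \<comment> \<open>The lift of \<open>ket k\<close> differs from \<open>ket (Trunk k)\<close>
          by a multiple of a branch vector if k is between 1 and k0, and not at all
          otherwise.\<close>
        have lk: "trunk_lift (ket k) \<in> N" by (rule lift) (simp add: ell2_ket)
        show ?thesis
        proof (cases "1 \<le> k \<and> k \<le> int k0")
          case True
          let ?c = "complex_of_real (branch_coeff (nat k))"
          have "(trunk_lift (ket k) - scale_fun ?c (ket (Branch (nat k)))) x = ket v x" for x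
            using Trunk True by (cases x) (auto simp: trunk_lift_def ket_def scale_fun_def)
          then have "trunk_lift (ket k) - scale_fun ?c (ket (Branch (nat k))) = ket v" by blast
          moreover have "ket (Branch (nat k)) \<in> N"
            using True by (intro branch) auto
          ultimately show ?thesis
            using closed_subspaceD(4,5)[OF N] lk by metis
        next
          case False
          have "trunk_lift (ket k) x = ket v x" for x
            using Trunk False by (cases x) (auto simp: trunk_lift_def ket_def)
          then have "trunk_lift (ket k) = ket v" by blast
          then show ?thesis using lk by simp
        qed
      qed
    qed
  qed
qed

end

section \<open>The unweighted bilateral shift\<close>

definition fourier :: "(complex \<Rightarrow> complex) \<Rightarrow> int \<Rightarrow> complex" where
  "fourier \<phi> k = integral {0..1} (\<lambda>t. \<phi> (cis (2 * pi * t)) * cis (2 * pi * t) powi (- k))"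

text \<open>Orthonormality of the characters: for nonzero k the antiderivative takes equal values at
  0 and 1.\<close>

lemma has_integral_cis_powi:
  "((\<lambda>t. cis (2 * pi * t) powi k) has_integral (if k = 0 then 1 else 0)) {0..1::real}"
proof (cases "k = 0")
  case True
  then show ?thesis
    using has_integral_const_real[of "1::complex" 0 1] by simp
next
  case False
  define c where "c = 2 * pi * of_int k"
  have c: "c \<noteq> 0" using False by (simp add: c_def)
  have "((\<lambda>t. cis (c * t)) has_integral (cis (c * 1) / (\<i> * c) - cis (c * 0) / (\<i> * c))) {0..1}"
  proof (rule fundamental_theorem_of_calculus)
    fix t :: real
    show "((\<lambda>t. cis (c * t) / (\<i> * c)) has_vector_derivative cis (c * t)) (at t within {0..1})"
      unfolding cis_conv_exp using c
      by (auto intro!: derivative_eq_intros has_vector_derivative_real_field simp: field_simps)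
  qed simp
  moreover have "cis (c * 1) = 1"
    using cis_multiple_2pi[of "of_int k"] by (simp add: c_def)
  ultimately show ?thesis
    using False by (simp add: cis_power_int c_def mult_ac)
qed

lemma continuous_on_circle_comp:
  assumes "continuous_on (sphere 0 1) \<phi>"
  shows "continuous_on X (\<lambda>t. \<phi> (cis (2 * pi * t)))"
  by (rule continuous_on_compose2[OF assms]) (auto intro!: continuous_intros)

lemma fourier_has_integral:
  assumes "continuous_on (sphere 0 1) \<phi>"
  shows "((\<lambda>t. \<phi> (cis (2 * pi * t)) * cis (2 * pi * t) powi (- k)) has_integral fourier \<phi> k) {0..1}"
  unfolding fourier_def
  by (intro integrable_integral integrable_continuous_interval continuous_intros
      continuous_on_circle_comp assms) auto

lemma continuous_on_circle_powi: "continuous_on (sphere 0 1) (\<lambda>z::complex. z powi k)"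
  by (intro continuous_intros) auto

lemma fourier_trig_poly:
  assumes "finite F"
  shows "fourier (\<lambda>z. \<Sum>k\<in>F. c k * z powi k) l = (if l \<in> F then c l else 0)"
proof -
  have *: "(\<Sum>k\<in>F. c k * cis (2 * pi * t) powi k) * cis (2 * pi * t) powi (- l)
      = (\<Sum>k\<in>F. c k * cis (2 * pi * t) powi (k - l))" for t
    by (simp add: sum_distrib_right power_int_diff power_int_minus divide_inverse mult.assoc)
  have "((\<lambda>t. \<Sum>k\<in>F. c k * cis (2 * pi * t) powi (k - l)) has_integral
      (\<Sum>k\<in>F. c k * (if k - l = 0 then 1 else 0))) {0..1}"
    by (intro has_integral_sum assms has_integral_mult_right has_integral_cis_powi)
  then have "fourier (\<lambda>z. \<Sum>k\<in>F. c k * z powi k) l = (\<Sum>k\<in>F. c k * (if k - l = 0 then 1 else 0))"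
    unfolding fourier_def * by (rule integral_unique)
  also have "\<dots> = (\<Sum>k\<in>F. if k = l then c k else 0)"
    by (intro sum.cong) auto
  finally show ?thesis using assms by simp
qed

lemma fourier_powi: "fourier (\<lambda>z. z powi k) = ket k"
  using fourier_trig_poly[of "{k}" "\<lambda>_. 1"] by (auto simp: ket_def fun_eq_iff)

lemma fourier_add:
  assumes "continuous_on (sphere 0 1) \<phi>" "continuous_on (sphere 0 1) \<psi>"
  shows "fourier (\<lambda>z. \<phi> z + \<psi> z) = fourier \<phi> + fourier \<psi>"
proof
  fix k
  show "fourier (\<lambda>z. \<phi> z + \<psi> z) k = (fourier \<phi> + fourier \<psi>) k"
    using integral_unique[OF has_integral_add[OF fourier_has_integral[OF assms(1)] fourier_has_integral[OF assms(2)]], of k]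
    by (simp add: fourier_def[of "\<lambda>z. \<phi> z + \<psi> z"] ring_distribs)
qed

lemma fourier_scale: "fourier (\<lambda>z. c * \<phi> z) = scale_fun c (fourier \<phi>)"
  by (simp add: fourier_def scale_fun_def fun_eq_iff mult.assoc)

lemma fourier_diff:
  assumes "continuous_on (sphere 0 1) \<phi>" "continuous_on (sphere 0 1) \<psi>"
  shows "fourier (\<lambda>z. \<phi> z - \<psi> z) = fourier \<phi> - fourier \<psi>"
proof
  fix k
  show "fourier (\<lambda>z. \<phi> z - \<psi> z) k = (fourier \<phi> - fourier \<psi>) k"
    using integral_unique[OF has_integral_diff[OF fourier_has_integral[OF assms(1)] fourier_has_integral[OF assms(2)]], of k]
    by (simp add: fourier_def[of "\<lambda>z. \<phi> z - \<psi> z"] ring_distribs)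
qed

lemma fourier_shift: "fourier (\<lambda>z. z * \<phi> z) k = fourier \<phi> (k - 1)"
proof -
  have "cis x powi (1 - k) = cis x * cis x powi (- k)" for x
    using power_int_add[of "cis x" 1 "- k"] by simp
  then show ?thesis by (simp add: fourier_def mult_ac)
qed

text \<open>With s the Fourier sum of \<open>\<phi>\<close> over F, the products of
  \<open>\<phi>\<close> with cnj s, of s with cnj s and of s with cnj \<open>\<phi>\<close> all
  integrate to \<open>?A\<close>. The integral of the squared modulus of \<open>\<phi>\<close> - s
  is therefore \<open>?N - ?A\<close>, and it is nonnegative.\<close>

lemma bessel:
  assumes \<phi>: "continuous_on (sphere 0 1) \<phi>" and F: "finite F"
  shows "(\<Sum>k\<in>F. (cmod (fourier \<phi> k))\<^sup>2) \<le> integral {0..1} (\<lambda>t. (cmod (\<phi> (cis (2 * pi * t))))\<^sup>2)"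
    (is "?A \<le> ?N")
proof -
  define c where "c = fourier \<phi>"
  define s where "s z = (\<Sum>k\<in>F. c k * z powi k)" for z
  let ?e = "\<lambda>t. cis (2 * pi * t)"
  have s: "continuous_on (sphere 0 1) s"
    unfolding s_def by (intro continuous_intros) auto
  have cs: "cnj (s (?e t)) = (\<Sum>k\<in>F. cnj (c k) * ?e t powi (- k))" for t
    by (simp add: s_def cis_power_int cis_cnj)
  have prod: "((\<lambda>t. \<psi> (?e t) * cnj (s (?e t))) has_integral (\<Sum>k\<in>F. cnj (c k) * fourier \<psi> k)) {0..1}"
    if "continuous_on (sphere 0 1) \<psi>" for \<psi>
  proof -
    have "((\<lambda>t. \<Sum>k\<in>F. cnj (c k) * (\<psi> (?e t) * ?e t powi (- k))) has_integral
        (\<Sum>k\<in>F. cnj (c k) * fourier \<psi> k)) {0..1}"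
      by (intro has_integral_sum F has_integral_mult_right fourier_has_integral that)
    moreover have "\<psi> (?e t) * cnj (s (?e t)) = (\<Sum>k\<in>F. cnj (c k) * (\<psi> (?e t) * ?e t powi (- k)))" for t
      unfolding cs by (simp add: sum_distrib_left mult.left_commute)
    ultimately show ?thesis by (simp only:)
  qed
  have A: "(\<Sum>k\<in>F. cnj (c k) * c k) = of_real ?A"
    unfolding of_real_sum c_def complex_norm_square by (simp add: mult.commute)
  have 1: "((\<lambda>t. \<phi> (?e t) * cnj (s (?e t))) has_integral of_real ?A) {0..1}"
    using prod[OF \<phi>] A by (simp add: c_def)
  have 2: "((\<lambda>t. s (?e t) * cnj (s (?e t))) has_integral of_real ?A) {0..1}"
  proof -
    have "fourier s k = c k" if "k \<in> F" for k
      unfolding s_def using fourier_trig_poly[OF F] that by simp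
    then have "(\<Sum>k\<in>F. cnj (c k) * fourier s k) = of_real ?A"
      unfolding A[symmetric] by (intro sum.cong) auto
    then show ?thesis using prod[OF s] by simp
  qed
  have 3: "((\<lambda>t. s (?e t) * cnj (\<phi> (?e t))) has_integral of_real ?A) {0..1}"
    using iffD2[OF has_integral_cnj 1] by (simp add: o_def mult.commute)
  have 4: "((\<lambda>t. (cmod (\<phi> (?e t)))\<^sup>2) has_integral ?N) {0..1}"
    by (intro integrable_integral integrable_continuous_interval continuous_intros
      continuous_on_circle_comp \<phi>)
  have 5: "((\<lambda>t. Re (\<phi> (?e t) * cnj (s (?e t)))) has_integral ?A) {0..1}"
    and 6: "((\<lambda>t. Re (s (?e t) * cnj (s (?e t)))) has_integral ?A) {0..1}"
    and 7: "((\<lambda>t. Re (s (?e t) * cnj (\<phi> (?e t)))) has_integral ?A) {0..1}"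
    using has_integral_Re[OF 1] has_integral_Re[OF 2] has_integral_Re[OF 3] by simp_all
  have "((\<lambda>t. (cmod (\<phi> (?e t)))\<^sup>2 - Re (\<phi> (?e t) * cnj (s (?e t))) - Re (s (?e t) * cnj (\<phi> (?e t)))
      + Re (s (?e t) * cnj (s (?e t)))) has_integral (?N - ?A - ?A + ?A)) {0..1}"
    by (intro has_integral_add has_integral_diff 4 5 6 7)
  moreover have eq: "(cmod u)\<^sup>2 - Re (u * cnj v) - Re (v * cnj u) + Re (v * cnj v) = (cmod (u - v))\<^sup>2" for u v
    unfolding cmod_power2 by (simp add: power2_eq_square algebra_simps)
  ultimately have "((\<lambda>t. (cmod (\<phi> (?e t) - s (?e t)))\<^sup>2) has_integral (?N - ?A - ?A + ?A)) {0..1}"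
    unfolding eq by blast
  then have "((\<lambda>t. (cmod (\<phi> (?e t) - s (?e t)))\<^sup>2) has_integral (?N - ?A)) {0..1}"
    by (simp only: diff_add_cancel)
  then have "0 \<le> ?N - ?A" by (rule has_integral_nonneg) simp
  then show ?thesis by simp
qed

lemma fourier_ell2_norm:
  assumes "continuous_on (sphere 0 1) \<phi>"
  shows fourier_ell2: "fourier \<phi> \<in> ell2 UNIV"
    and fourier_norm: "ell2_norm UNIV (fourier \<phi>) \<le> sqrt (integral {0..1} (\<lambda>t. (cmod (\<phi> (cis (2 * pi * t))))\<^sup>2))"
proof -
  let ?N = "integral {0..1} (\<lambda>t. (cmod (\<phi> (cis (2 * pi * t))))\<^sup>2)"
  have 0: "0 \<le> ?N"
    using bessel[OF assms, of "{}"] by simp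
  have *: "(\<Sum>k\<in>F. (cmod (fourier \<phi> k))\<^sup>2) \<le> (sqrt ?N)\<^sup>2" if "finite F" for F
    using bessel[OF assms that] 0 by simp
  show "fourier \<phi> \<in> ell2 UNIV"
    by (rule ell2I_bounded(1)[OF _ _ *]) (use 0 in auto)
  show "ell2_norm UNIV (fourier \<phi>) \<le> sqrt ?N"
    by (rule ell2I_bounded(2)[OF _ _ *]) (use 0 in auto)
qed

lemma fourier_norm_uniform:
  assumes \<phi>: "continuous_on (sphere 0 1) \<phi>" and "0 \<le> B" and bd: "\<And>z. z \<in> sphere 0 1 \<Longrightarrow> cmod (\<phi> z) \<le> B"
  shows "ell2_norm UNIV (fourier \<phi>) \<le> B"
proof -
  have "integral {0..1} (\<lambda>t. (cmod (\<phi> (cis (2 * pi * t))))\<^sup>2) \<le> integral {0..1::real} (\<lambda>t. B\<^sup>2)"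
  proof (rule integral_le)
    show "(\<lambda>t. (cmod (\<phi> (cis (2 * pi * t))))\<^sup>2) integrable_on {0..1}"
      by (intro integrable_continuous_interval continuous_intros continuous_on_circle_comp \<phi>)
  qed (auto intro!: power_mono bd)
  then show ?thesis
    by (intro order_trans[OF fourier_norm[OF \<phi>]] real_le_lsqrt) (use \<open>0 \<le> B\<close> in auto)
qed

section \<open>A cyclic function for multiplication by z\<close>

text \<open>Cyclicity of \<open>flat\<close> rests on the fact that its logarithm is not integrable over the circle.\<close>

definition flat :: "complex \<Rightarrow> real" where
  "flat z = (if z = 1 then 0 else exp (- (4 / (cmod (1 - z))\<^sup>2)))"

lemma flat_nonneg: "0 \<le> flat z" and flat_le_one: "flat z \<le> 1" and flat_pos: "z \<noteq> 1 \<Longrightarrow> 0 < flat z"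
  by (auto simp: flat_def)

lemma continuous_on_flat: "continuous_on X flat"
proof -
  have "isCont flat z" for z
  proof (cases "z = 1")
    case True
    \<comment> \<open>From exp (-u) at most 1 / u with u = 4 / |1 - w|^2; continuity at 1 follows by
      squeezing.\<close>
    have bd: "flat w \<le> (cmod (1 - w))\<^sup>2 / 4" for w
    proof (cases "w = 1")
      case False
      have "exp (- u) \<le> 1 / u" if "u > 0" for u :: real
        using exp_gt_self[of u] that by (simp add: exp_minus field_simps less_imp_le)
      from this[of "4 / (cmod (1 - w))\<^sup>2"] False show ?thesis by (simp add: flat_def)
    qed (simp add: flat_def)
    have "(flat \<longlongrightarrow> 0) (at 1)"
    proof (rule tendsto_sandwich[OF _ _ tendsto_const])
      show "((\<lambda>w. (cmod (1 - w))\<^sup>2 / 4) \<longlongrightarrow> 0) (at 1)"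
        by (auto intro!: tendsto_eq_intros)
      show "eventually (\<lambda>w. flat w \<le> (cmod (1 - w))\<^sup>2 / 4) (at 1)"
        by (rule always_eventually) (use bd in blast)
    qed (simp add: flat_nonneg)
    then show ?thesis using True by (simp add: isCont_def flat_def)
  next
    case False
    have "isCont (\<lambda>z. exp (- (4 / (cmod (1 - z))\<^sup>2))) z"
      using False by (intro continuous_intros) auto
    moreover have "eventually (\<lambda>w. w \<noteq> 1) (nhds z)"
      using False by (rule t1_space_nhds)
    then have "eventually (\<lambda>w. exp (- (4 / (cmod (1 - w))\<^sup>2)) = flat w) (nhds z)"
      by eventually_elim (simp add: flat_def)
    ultimately show ?thesis by (simp add: isCont_cong)
  qed
  then show ?thesis by (simp add: continuous_at_imp_continuous_on)
qed

text \<open>The quotient is \<open>(1 + \<rho>z) / (1 - \<rho>z) - 1\<close>, whose real part is the Poisson kernel minus \<open>1\<close>.\<close>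

lemma Re_peak_le:
  fixes n :: nat
  assumes z: "cmod z = 1" "z \<noteq> 1" and n: "n \<ge> 2" and \<rho>: "\<rho> = 1 - 1 / real n"
  shows "real n * Re (2 * of_real \<rho> * z / (1 - of_real \<rho> * z)) \<le> 4 / (cmod (1 - z))\<^sup>2 - n"
proof -
  define x y where "x = Re z" and "y = Im z"
  have xy: "x\<^sup>2 + y\<^sup>2 = 1"
    using z(1) unfolding x_def y_def by (metis cmod_power2 one_power2)
  have rho: "1/2 \<le> \<rho>" "\<rho> < 1" "real n * (1 - \<rho>) = 1"
    using n by (auto simp: \<rho> field_simps)
  \<comment> \<open>The squared modulus of the denominator 1 - \<open>\<rho>\<close> z.\<close>
  define d where "d = (1 - \<rho> * x)\<^sup>2 + (\<rho> * y)\<^sup>2"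
  have d: "d = 1 - 2 * \<rho> * x + \<rho>\<^sup>2"
    using xy by (simp add: d_def power2_eq_square algebra_simps) algebra
  have x1: "x < 1"
  proof -
    have "x \<le> 1" using xy by (metis abs_le_square_iff abs_ge_self abs_one le_add_same_cancel1 one_power2 order_trans zero_le_power2)
    moreover have "x \<noteq> 1" using xy z(2) by (auto simp: x_def y_def complex_eq_iff)
    ultimately show ?thesis by simp
  qed
  have m: "(cmod (1 - z))\<^sup>2 = 2 * (1 - x)"
  proof -
    have "(cmod (1 - z))\<^sup>2 = (1 - x)\<^sup>2 + y\<^sup>2" by (simp add: cmod_power2 x_def y_def)
    then show ?thesis using xy by (simp add: power2_eq_square algebra_simps)
  qed
  \<comment> \<open>Here n at least 2 matters: it makes \<open>\<rho>\<close> at least 1/2.\<close>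
  have dge: "1 - x \<le> d"
  proof -
    have "d = (1 - \<rho>)\<^sup>2 + 2 * \<rho> * (1 - x)" by (simp add: d power2_eq_square algebra_simps)
    moreover have "1 * (1 - x) \<le> 2 * \<rho> * (1 - x)"
      using rho x1 by (intro mult_right_mono) auto
    ultimately show ?thesis by (smt (verit) zero_le_power2)
  qed
  have dpos: "d > 0" using dge x1 by simp
  have "Re (2 * of_real \<rho> * z / (1 - of_real \<rho> * z)) = (2 * \<rho> * x * (1 - \<rho> * x) - 2 * \<rho> * y * (\<rho> * y)) / d"
    by (simp add: Re_divide x_def y_def d_def)
  also have "2 * \<rho> * x * (1 - \<rho> * x) - 2 * \<rho> * y * (\<rho> * y) = 1 - \<rho>\<^sup>2 - d"
  proof -
    have "2 * \<rho> * x * (1 - \<rho> * x) - 2 * \<rho> * y * (\<rho> * y) = 2 * \<rho> * x - 2 * \<rho>\<^sup>2 * (x\<^sup>2 + y\<^sup>2)"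
      by (simp add: power2_eq_square algebra_simps)
    then show ?thesis by (simp add: xy d)
  qed
  finally have R: "Re (2 * of_real \<rho> * z / (1 - of_real \<rho> * z)) = (1 - \<rho>\<^sup>2 - d) / d" .
  \<comment> \<open>The product n (1 - \<open>\<rho>\<close>) equals 1, so the height of the peak is
    bounded independently of n, while the term -n remains.\<close>
  have "real n * Re (2 * of_real \<rho> * z / (1 - of_real \<rho> * z)) = real n * (1 - \<rho>) * (1 + \<rho>) / d - n"
    unfolding R using dpos by (simp add: field_simps power2_eq_square)
  also have "\<dots> = (1 + \<rho>) / d - n"
    by (simp add: rho)
  also have "\<dots> \<le> 2 / (1 - x) - n"
    using rho dge dpos x1 by (intro diff_right_mono frac_le) auto
  \<comment> \<open>Up to sign this is the exponent of \<open>flat\<close>.\<close>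
  also have "2 / (1 - x) = 4 / (cmod (1 - z))\<^sup>2"
    unfolding m using x1 by (simp add: field_simps)
  finally show ?thesis .
qed

text \<open>The polynomial is a Taylor polynomial of \<open>r z = exp (n ((1 + \<rho>z) / (1 - \<rho>z) - 1))\<close>: its value at
  \<open>0\<close> is \<open>1\<close>, on the circle it has size \<open>exp (-n)\<close> away from \<open>1\<close>, and \<open>flat\<close> absorbs its peak at \<open>1\<close>.\<close>

lemma flat_annihilated:
  assumes e: "e > 0"
  obtains K :: nat and a :: "nat \<Rightarrow> complex" where
    "\<And>z. z \<in> sphere 0 1 \<Longrightarrow> cmod ((1 + (\<Sum>k\<in>{1..K}. a k * z ^ k)) * of_real (flat z)) \<le> e"
proof -
  obtain n :: nat where n: "n \<ge> 2" "exp (- real n) < e / 2"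
  proof -
    have "((\<lambda>n. exp (- real n)) \<longlongrightarrow> 0) sequentially" by real_asymp
    then have "eventually (\<lambda>n. exp (- real n) < e / 2) sequentially"
      using e by (intro order_tendstoD) auto
    then have "eventually (\<lambda>n. n \<ge> 2 \<and> exp (- real n) < e / 2) sequentially"
      by (intro eventually_conj eventually_ge_at_top)
    then show ?thesis using that eventually_happens' sequentially_bot by blast
  qed
  define \<rho> where "\<rho> = 1 - 1 / real n"
  have rho: "1/2 \<le> \<rho>" "\<rho> < 1" using n by (auto simp: \<rho>_def field_simps)
  define r where "r z = exp (of_nat n * (2 * of_real \<rho> * z / (1 - of_real \<rho> * z)))" for z :: complex
  have den: "1 - of_real \<rho> * z \<noteq> 0" if "z \<in> ball 0 (1 / \<rho>)" for z :: complex
  proof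
    assume "1 - of_real \<rho> * z = 0"
    then have "cmod (of_real \<rho> * z) = 1" by (metis eq_iff_diff_eq_0 norm_one)
    then show False using that rho by (simp add: norm_mult field_simps)
  qed
  have hol: "r holomorphic_on ball 0 (1 / \<rho>)"
    unfolding r_def using den by (intro holomorphic_intros) auto
  define a where "a k = (deriv ^^ k) r 0 / fact k" for k
  have sums: "(\<lambda>k. a k * z ^ k) sums r z" if "z \<in> ball 0 (1 / \<rho>)" for z
    using holomorphic_power_series[OF hol that] by (simp add: a_def)
  have a0: "a 0 = 1" by (simp add: a_def r_def)
  \<comment> \<open>The radius of convergence exceeds 1, so the Taylor coefficients are absolutely
    summable and the Taylor polynomials converge to r uniformly on the circle.\<close>
  have abs: "summable (\<lambda>k. cmod (a k))"
  proof -
    obtain s where s: "1 < s" "s < 1 / \<rho>"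
      using dense[of 1 "1 / \<rho>"] rho by (auto simp: field_simps)
    have "summable (\<lambda>k. a k * of_real s ^ k)"
      using sums[of "of_real s"] s by (auto simp: sums_iff)
    from powser_insidea[OF this, of 1] s show ?thesis by simp
  qed
  obtain K where K: "(\<Sum>k. cmod (a (k + K))) < e / 2"
  proof -
    obtain N where "\<forall>m\<ge>N. norm (\<Sum>i. cmod (a (i + m))) < e / 2"
      using suminf_exist_split[OF _ abs, of "e / 2"] e by auto
    then have "norm (\<Sum>i. cmod (a (i + N))) < e / 2" by blast
    then show ?thesis using that[of N] by simp
  qed
  have "cmod ((1 + (\<Sum>k\<in>{1..K}. a k * z ^ k)) * of_real (flat z)) \<le> e" if z: "z \<in> sphere 0 1" for z
  proof (cases "z = 1")
    case True
    then show ?thesis using e by (simp add: flat_def)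
  next
    case False
    have z1: "cmod z = 1" using z by simp
    have zb: "z \<in> ball 0 (1 / \<rho>)" using z1 rho by (simp add: field_simps)
    have poly: "1 + (\<Sum>k\<in>{1..K}. a k * z ^ k) = (\<Sum>k<Suc K. a k * z ^ k)"
    proof -
      have "{..<Suc K} = insert 0 {1..K}" by auto
      then show ?thesis by (simp add: a0)
    qed
    have abs': "summable (\<lambda>k. cmod (a (k + Suc K)))"
      using abs by (subst summable_iff_shift) 
    have "cmod (r z - (\<Sum>k<Suc K. a k * z ^ k)) = cmod (\<Sum>k. a (k + Suc K) * z ^ (k + Suc K))"
      using suminf_minus_initial_segment[of "\<lambda>k. a k * z ^ k" "Suc K"] sums[OF zb] by (simp add: sums_iff)
    also have "\<dots> \<le> (\<Sum>k. cmod (a (k + Suc K)))"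
      using abs' z1 by (intro norm_suminf_le) (simp_all add: norm_mult norm_power)
    \<comment> \<open>The polynomial contains the term of index K, so its tail starts at K + 1 and
      is bounded by the tail from K.\<close>
    also have "\<dots> \<le> (\<Sum>k. cmod (a (k + K)))"
    proof -
      have "summable (\<lambda>k. cmod (a (k + K)))" using abs by (subst summable_iff_shift)
      from suminf_split_head[OF this] show ?thesis by simp
    qed
    finally have tail: "cmod (r z - (\<Sum>k<Suc K. a k * z ^ k)) \<le> e / 2" using K by simp
    \<comment> \<open>The factor \<open>flat z\<close> cancels the z-dependent part of the bound on
      r and leaves exp (-n).\<close>
    have peak: "cmod (r z) * flat z \<le> e / 2"
    proof -
      have "cmod (r z) = exp (real n * Re (2 * of_real \<rho> * z / (1 - of_real \<rho> * z)))"
      proof -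
        have "Re (of_nat n * w) = real n * Re w" for w by simp
        then show ?thesis by (simp only: r_def norm_exp_eq_Re)
      qed
      also have "\<dots> \<le> exp (4 / (cmod (1 - z))\<^sup>2 - n)"
        using Re_peak_le[OF z1 False n(1) \<rho>_def] by simp
      finally have "cmod (r z) * flat z \<le> exp (4 / (cmod (1 - z))\<^sup>2 - n) * flat z"
        by (intro mult_right_mono flat_nonneg)
      also have "\<dots> = exp (- real n)"
        using False by (simp add: flat_def flip: exp_add)
      finally show ?thesis using n by simp
    qed
    have "cmod ((\<Sum>k<Suc K. a k * z ^ k) * of_real (flat z))
        \<le> cmod (r z * of_real (flat z)) + cmod ((r z - (\<Sum>k<Suc K. a k * z ^ k)) * of_real (flat z))"
      using norm_triangle_ineq4[of "r z * of_real (flat z)" "(r z - (\<Sum>k<Suc K. a k * z ^ k)) * of_real (flat z)"]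
      by (simp only: left_diff_distrib diff_diff_eq2 add_diff_cancel_left')
    also have "\<dots> \<le> e / 2 + e / 2 * 1"
    proof (intro add_mono)
      show "cmod (r z * of_real (flat z)) \<le> e / 2"
        using peak by (simp add: norm_mult flat_nonneg)
      have "cmod (r z - (\<Sum>k<Suc K. a k * z ^ k)) * flat z \<le> e / 2 * 1"
        using tail e by (intro mult_mono flat_le_one flat_nonneg) auto
      then show "cmod ((r z - (\<Sum>k<Suc K. a k * z ^ k)) * of_real (flat z)) \<le> e / 2 * 1"
        by (simp add: norm_mult flat_nonneg del: sum.lessThan_Suc)
    qed
    finally show ?thesis unfolding poly by simp
  qed
  then show ?thesis using that by blast
qed

section \<open>Continuous functions represented in a closed subspace\<close>

definition fourier_vimage :: "(int \<Rightarrow> complex) set \<Rightarrow> (complex \<Rightarrow> complex) set" where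
  "fourier_vimage N = {\<phi>. continuous_on (sphere 0 1) \<phi> \<and> fourier \<phi> \<in> N}"

lemma fourier_vimage_add:
  assumes "closed_subspace UNIV N" "\<phi> \<in> fourier_vimage N" "\<psi> \<in> fourier_vimage N"
  shows "(\<lambda>z. \<phi> z + \<psi> z) \<in> fourier_vimage N"
  using assms closed_subspaceD(3)[OF assms(1)]
  by (auto simp: fourier_vimage_def fourier_add intro: continuous_intros)

lemma fourier_vimage_scale:
  assumes "closed_subspace UNIV N" "\<phi> \<in> fourier_vimage N"
  shows "(\<lambda>z. c * \<phi> z) \<in> fourier_vimage N"
  using assms closed_subspaceD(4)[OF assms(1)]
  by (auto simp: fourier_vimage_def fourier_scale intro: continuous_intros)

lemma fourier_vimage_sum:
  assumes N: "closed_subspace UNIV N" and "finite F" and "\<And>k. k \<in> F \<Longrightarrow> \<phi> k \<in> fourier_vimage N"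
  shows "(\<lambda>z. \<Sum>k\<in>F. \<phi> k z) \<in> fourier_vimage N"
  using assms(2,3)
proof (induction F rule: finite_induct)
  case empty
  have "fourier (\<lambda>z. 0) = 0" using fourier_scale[of 0 "\<lambda>z. 0"] by (simp add: fun_eq_iff scale_fun_def)
  then show ?case using closed_subspaceD(2)[OF N] by (simp add: fourier_vimage_def)
next
  case (insert k F)
  then show ?case using fourier_vimage_add[OF N, of "\<phi> k" "\<lambda>z. \<Sum>k\<in>F. \<phi> k z"] by simp
qed

text \<open>By Bessel's inequality a mean-square approximation gives an approximation of the
  coefficients. The mean-square form serves the final limit, where the approximants vanish at 1 and
  cannot converge uniformly.\<close>

lemma fourier_vimage_L2:
  assumes N: "closed_subspace UNIV N" and \<phi>: "continuous_on (sphere 0 1) \<phi>"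
    and ap: "\<And>e. e > 0 \<Longrightarrow> \<exists>\<psi>\<in>fourier_vimage N.
      integral {0..1} (\<lambda>t. (cmod (\<phi> (cis (2 * pi * t)) - \<psi> (cis (2 * pi * t))))\<^sup>2) < e"
  shows "\<phi> \<in> fourier_vimage N"
proof -
  have "fourier \<phi> \<in> N"
  proof (rule closed_subspaceD(6)[OF N fourier_ell2[OF \<phi>]])
    fix e :: real assume e: "e > 0"
    then obtain \<psi> where \<psi>: "\<psi> \<in> fourier_vimage N"
      "integral {0..1} (\<lambda>t. (cmod (\<phi> (cis (2 * pi * t)) - \<psi> (cis (2 * pi * t))))\<^sup>2) < e\<^sup>2"
      using ap[of "e\<^sup>2"] by auto
    then have c: "continuous_on (sphere 0 1) \<psi>" by (simp add: fourier_vimage_def)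
    have "ell2_norm UNIV (fourier \<phi> - fourier \<psi>)
        \<le> sqrt (integral {0..1} (\<lambda>t. (cmod (\<phi> (cis (2 * pi * t)) - \<psi> (cis (2 * pi * t))))\<^sup>2))"
      unfolding fourier_diff[OF \<phi> c, symmetric]
      by (rule fourier_norm) (intro continuous_intros \<phi> c)
    also have "\<dots> < e"
      using \<psi>(2) e by (intro real_less_lsqrt) auto
    finally show "\<exists>y\<in>N. ell2_norm UNIV (fourier \<phi> - y) < e"
      using \<psi>(1) by (auto simp: fourier_vimage_def)
  qed
  then show ?thesis using \<phi> by (simp add: fourier_vimage_def)
qed

lemma fourier_vimage_uniform:
  assumes N: "closed_subspace UNIV N" and \<phi>: "continuous_on (sphere 0 1) \<phi>"
    and ap: "\<And>e. e > 0 \<Longrightarrow> \<exists>\<psi>\<in>fourier_vimage N. \<forall>z\<in>sphere 0 1. cmod (\<phi> z - \<psi> z) \<le> e"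
  shows "\<phi> \<in> fourier_vimage N"
proof -
  have "fourier \<phi> \<in> N"
  proof (rule closed_subspaceD(6)[OF N fourier_ell2[OF \<phi>]])
    fix e :: real assume e: "e > 0"
    then obtain \<psi> where \<psi>: "\<psi> \<in> fourier_vimage N" "\<forall>z\<in>sphere 0 1. cmod (\<phi> z - \<psi> z) \<le> e / 2"
      using ap[of "e / 2"] by auto
    then have c: "continuous_on (sphere 0 1) \<psi>" by (simp add: fourier_vimage_def)
    have "ell2_norm UNIV (fourier \<phi> - fourier \<psi>) \<le> e / 2"
      unfolding fourier_diff[OF \<phi> c, symmetric]
      by (rule fourier_norm_uniform) (use \<psi> e in \<open>auto intro!: continuous_intros \<phi> c\<close>)
    then show "\<exists>y\<in>N. ell2_norm UNIV (fourier \<phi> - y) < e"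
      using \<psi>(1) e by (intro bexI[of _ "fourier \<psi>"]) (auto simp: fourier_vimage_def)
  qed
  then show ?thesis using \<phi> by (simp add: fourier_vimage_def)
qed

definition bilateral_shift :: "(int \<Rightarrow> complex) \<Rightarrow> int \<Rightarrow> complex" where
  "bilateral_shift f k = f (k - 1)"

lemma bilateral_shift_map: "bilateral_shift \<in> ell2_maps UNIV UNIV"
proof -
  have "(\<lambda>(f :: int \<Rightarrow> complex) k. if k \<in> UNIV then 1 * f (k - 1) else 0) \<in> ell2_maps UNIV UNIV"
    by (rule ell2_maps_weighted[where M = 1]) (auto simp: inj_on_def)
  then show ?thesis by (simp add: bilateral_shift_def[abs_def])
qed

lemma bilateral_shift_power_fourier: "(bilateral_shift ^^ n) (fourier \<phi>) = fourier (\<lambda>z. z ^ n * \<phi> z)"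
proof (induction n)
  case (Suc n)
  have "fourier (\<lambda>z. z ^ Suc n * \<phi> z) = fourier (\<lambda>z. z * (z ^ n * \<phi> z))"
    by (simp add: mult.assoc)
  also have "\<dots> = bilateral_shift (fourier (\<lambda>z. z ^ n * \<phi> z))"
    by (simp add: fun_eq_iff fourier_shift bilateral_shift_def)
  finally show ?case using Suc by simp
qed simp

lemma powi_flat_continuous: "continuous_on (sphere 0 1) (\<lambda>z. z powi m * of_real (flat z))"
  by (intro continuous_intros continuous_on_flat) auto

text \<open>Dividing by \<open>z\<close> stays inside the subspace: \<open>z\<^sup>-\<^sup>1\<close> times the vanishing combination of
  \<open>flat_annihilated\<close> expresses \<open>z\<^sup>-\<^sup>1 * flat\<close> through nonnegative powers.\<close>

lemma powi_flat_in_vimage: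
  assumes N: "closed_subspace UNIV N"
    and orb: "\<And>n::nat. (\<lambda>z. z ^ n * of_real (flat z)) \<in> fourier_vimage N"
  shows "(\<lambda>z. z powi m * of_real (flat z)) \<in> fourier_vimage N"
proof -
  \<comment> \<open>The induction is on how far the exponent may lie below 0; the nonnegative
    exponents are the orbit itself.\<close>
  have "(\<lambda>z. z powi m * of_real (flat z)) \<in> fourier_vimage N" if "m \<ge> - int j" for j m
    using that
  proof (induction j arbitrary: m)
    case 0
    then show ?case using orb[of "nat m"] by (simp add: power_int_def)
  next
    case (Suc j)
    show ?case
    proof (rule fourier_vimage_uniform[OF N powi_flat_continuous])
      fix e :: real assume "e > 0"
      then obtain K a where Ka:
        "\<And>z. z \<in> sphere 0 1 \<Longrightarrow> cmod ((1 + (\<Sum>k\<in>{1..K}. a k * z ^ k)) * of_real (flat z)) \<le> e"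
        using flat_annihilated by metis
      let ?\<psi> = "\<lambda>z. \<Sum>k\<in>{1..K}. - a k * (z powi (m + int k) * of_real (flat z))"
      have "?\<psi> \<in> fourier_vimage N"
      proof (intro fourier_vimage_sum fourier_vimage_scale N)
        \<comment> \<open>The sum starts at k = 1, so its exponents are at least -j and covered by
          the induction hypothesis.\<close>
        show "(\<lambda>z. z powi (m + int k) * of_real (flat z)) \<in> fourier_vimage N" if "k \<in> {1..K}" for k
          using Suc.prems that by (intro Suc.IH) auto
      qed simp
      moreover have "cmod (z powi m * of_real (flat z) - ?\<psi> z) \<le> e" if z: "z \<in> sphere 0 1" for z
      proof -
        have "z \<noteq> 0" using z by auto
        then have "z powi m * of_real (flat z) - ?\<psi> z
            = z powi m * ((1 + (\<Sum>k\<in>{1..K}. a k * z ^ k)) * of_real (flat z))"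
          by (simp add: power_int_add sum_distrib_left sum_distrib_right ring_distribs sum_negf mult_ac)
        also have "cmod \<dots> = cmod ((1 + (\<Sum>k\<in>{1..K}. a k * z ^ k)) * of_real (flat z))"
          using z by (simp add: norm_mult norm_power_int)
        finally show ?thesis using Ka[OF z] by simp
      qed
      ultimately show "\<exists>\<psi>\<in>fourier_vimage N. \<forall>z\<in>sphere 0 1. cmod (z powi m * of_real (flat z) - \<psi> z) \<le> e"
        by (intro bexI[of _ ?\<psi>] ballI)
    qed
  qed
  from this[of "nat (- m)"] show ?thesis by simp
qed

section \<open>Trigonometric polynomials and their density\<close>

definition trig_poly :: "(complex \<Rightarrow> complex) \<Rightarrow> bool" where
  "trig_poly q \<longleftrightarrow> (\<exists>F c. finite F \<and> (\<forall>z\<in>sphere 0 1. q z = (\<Sum>k\<in>F. c k * z powi k)))"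

lemma trig_poly_monom: "trig_poly (\<lambda>z. c * z powi k)"
  unfolding trig_poly_def by (intro exI[of _ "{k}"] exI[of _ "\<lambda>_. c"]) simp

lemma trig_poly_cong:
  assumes "trig_poly p" "\<And>z. z \<in> sphere 0 1 \<Longrightarrow> q z = p z"
  shows "trig_poly q"
  using assms by (simp add: trig_poly_def)

lemma trig_poly_add:
  assumes "trig_poly p" "trig_poly q"
  shows "trig_poly (\<lambda>z. p z + q z)"
proof -
  obtain F c G d where p: "finite F" "\<And>z. z \<in> sphere 0 1 \<Longrightarrow> p z = (\<Sum>k\<in>F. c k * z powi k)"
    and q: "finite G" "\<And>z. z \<in> sphere 0 1 \<Longrightarrow> q z = (\<Sum>k\<in>G. d k * z powi k)"
    using assms unfolding trig_poly_def by metis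
  have "p z + q z = (\<Sum>k\<in>F \<union> G. ((if k \<in> F then c k else 0) + (if k \<in> G then d k else 0)) * z powi k)"
    if "z \<in> sphere 0 1" for z
  proof -
    have "(\<Sum>k\<in>F. c k * z powi k) = (\<Sum>k\<in>F \<union> G. (if k \<in> F then c k else 0) * z powi k)"
      "(\<Sum>k\<in>G. d k * z powi k) = (\<Sum>k\<in>F \<union> G. (if k \<in> G then d k else 0) * z powi k)"
      using p(1) q(1) by (auto intro!: sum.mono_neutral_cong_left)
    then show ?thesis unfolding p(2)[OF that] q(2)[OF that] by (simp add: ring_distribs sum.distrib)
  qed
  then show ?thesis unfolding trig_poly_def using p(1) q(1) by (meson finite_UnI)
qed

lemma trig_poly_sum:
  assumes "finite I" "\<And>i. i \<in> I \<Longrightarrow> trig_poly (q i)"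
  shows "trig_poly (\<lambda>z. \<Sum>i\<in>I. q i z)"
  using assms
proof (induction I rule: finite_induct)
  case empty
  then show ?case using trig_poly_monom[of 0 0] by simp
qed (simp add: trig_poly_add)

lemma trig_poly_mult:
  assumes "trig_poly p" "trig_poly q"
  shows "trig_poly (\<lambda>z. p z * q z)"
proof -
  obtain F c G d where p: "finite F" "\<And>z. z \<in> sphere 0 1 \<Longrightarrow> p z = (\<Sum>k\<in>F. c k * z powi k)"
    and q: "finite G" "\<And>z. z \<in> sphere 0 1 \<Longrightarrow> q z = (\<Sum>k\<in>G. d k * z powi k)"
    using assms unfolding trig_poly_def by metis
  have "trig_poly (\<lambda>z. \<Sum>k\<in>F. \<Sum>l\<in>G. (c k * d l) * z powi (k + l))"
    by (intro trig_poly_sum p(1) q(1) trig_poly_monom)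
  then show ?thesis
  proof (rule trig_poly_cong)
    fix z :: complex assume z: "z \<in> sphere 0 1"
    then have "z \<noteq> 0" by auto
    then show "p z * q z = (\<Sum>k\<in>F. \<Sum>l\<in>G. (c k * d l) * z powi (k + l))"
      unfolding p(2)[OF z] q(2)[OF z] by (simp add: sum_product power_int_add mult_ac)
  qed
qed

text \<open>Stone-Weierstrass for the real-valued continuous functions that agree with trigonometric
  polynomials on the circle. Re and Im belong to this algebra because 1 / z = cnj z there, and
  together they separate points.\<close>

lemma trig_poly_dense:
  fixes \<phi> :: "complex \<Rightarrow> real"
  assumes "continuous_on (sphere 0 1) \<phi>" "e > 0"
  obtains q where "trig_poly q" "\<And>z. z \<in> sphere 0 1 \<Longrightarrow> cmod (of_real (\<phi> z) - q z) < e"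
proof -
  let ?R = "{g :: complex \<Rightarrow> real. trig_poly (\<lambda>z. of_real (g z)) \<and> continuous_on (sphere 0 1) g}"
  have Re: "Re \<in> ?R"
  proof -
    have "trig_poly (\<lambda>z. 1/2 * z powi 1 + 1/2 * z powi (- 1))"
      by (intro trig_poly_add trig_poly_monom)
    moreover have "complex_of_real (Re z) = 1/2 * z powi 1 + 1/2 * z powi (- 1)" if "z \<in> sphere 0 1" for z
    proof -
      have "inverse z = cnj z"
        using that by (simp add: inverse_complex_def complex_eq_iff cmod_def)
      then show ?thesis by (simp add: power_int_minus complex_eq_iff)
    qed
    ultimately show ?thesis by (auto intro: trig_poly_cong continuous_intros)
  qed
  have Im: "Im \<in> ?R"
  proof -
    have "trig_poly (\<lambda>z. - \<i>/2 * z powi 1 + \<i>/2 * z powi (- 1))"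
      by (intro trig_poly_add trig_poly_monom)
    moreover have "complex_of_real (Im z) = - \<i>/2 * z powi 1 + \<i>/2 * z powi (- 1)" if "z \<in> sphere 0 1" for z
    proof -
      have "inverse z = cnj z"
        using that by (simp add: inverse_complex_def complex_eq_iff cmod_def)
      then show ?thesis by (simp add: power_int_minus complex_eq_iff)
    qed
    ultimately show ?thesis by (auto intro: trig_poly_cong continuous_intros)
  qed
  interpret function_ring_on ?R "sphere 0 1 :: complex set"
  proof
    show "(\<lambda>_. c) \<in> ?R" for c
      using trig_poly_monom[of "of_real c" 0] by simp
    show "\<exists>f\<in>?R. f x \<noteq> f y" if "x \<noteq> y" for x y
      using that Re Im by (metis complex_eqI)
  qed (auto intro: trig_poly_add trig_poly_mult continuous_intros)
  obtain g where "g \<in> ?R" "\<forall>z\<in>sphere 0 1. \<bar>\<phi> z - g z\<bar> < e"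
    using Stone_Weierstrass_basic[OF assms] by blast
  then show ?thesis
    using that[of "\<lambda>z. of_real (g z)"] by (simp flip: of_real_diff)
qed

text \<open>Since \<open>flat\<close> is at most 1, a uniform trigonometric approximation of
  \<open>\<phi>\<close> stays one after multiplication by \<open>flat\<close> and a power of z, and
  each of its terms is covered by \<open>powi_flat_in_vimage\<close>.\<close>

lemma continuous_flat_in_vimage:
  assumes N: "closed_subspace UNIV N"
    and orb: "\<And>n::nat. (\<lambda>z. z ^ n * of_real (flat z)) \<in> fourier_vimage N"
    and \<phi>: "continuous_on (sphere 0 1) \<phi>"
  shows "(\<lambda>z. z powi j * (of_real (\<phi> z) * of_real (flat z))) \<in> fourier_vimage N"
proof (rule fourier_vimage_uniform[OF N])
  show "continuous_on (sphere 0 1) (\<lambda>z. z powi j * (complex_of_real (\<phi> z) * of_real (flat z)))"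
    by (intro continuous_intros continuous_on_flat \<phi>) auto
  fix e :: real assume e: "e > 0"
  obtain q where q: "trig_poly q" "\<And>z. z \<in> sphere 0 1 \<Longrightarrow> cmod (of_real (\<phi> z) - q z) < e"
    using trig_poly_dense[OF \<phi> e] by blast
  obtain F c where F: "finite F" "\<And>z. z \<in> sphere 0 1 \<Longrightarrow> q z = (\<Sum>k\<in>F. c k * z powi k)"
    using q(1) unfolding trig_poly_def by metis
  let ?\<psi> = "\<lambda>z. \<Sum>k\<in>F. c k * (z powi (j + k) * of_real (flat z))"
  have "?\<psi> \<in> fourier_vimage N"
    by (intro fourier_vimage_sum fourier_vimage_scale N F powi_flat_in_vimage orb)
  moreover have "cmod (z powi j * (of_real (\<phi> z) * of_real (flat z)) - ?\<psi> z) \<le> e" if z: "z \<in> sphere 0 1" for z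
  proof -
    have "z \<noteq> 0" using z by auto
    then have "?\<psi> z = z powi j * (q z * of_real (flat z))"
      unfolding F(2)[OF z] by (simp add: power_int_add sum_distrib_left sum_distrib_right mult_ac)
    then have "z powi j * (of_real (\<phi> z) * of_real (flat z)) - ?\<psi> z
        = z powi j * ((of_real (\<phi> z) - q z) * of_real (flat z))"
      by (simp add: algebra_simps)
    also have "cmod \<dots> = cmod (of_real (\<phi> z) - q z) * flat z"
      using z by (simp add: norm_mult norm_power_int flat_nonneg)
    also have "\<dots> \<le> e * 1"
      using q(2)[OF z] e by (intro mult_mono flat_le_one flat_nonneg) auto
    finally show ?thesis by simp
  qed
  ultimately show "\<exists>\<psi>\<in>fourier_vimage N. \<forall>z\<in>sphere 0 1.
      cmod (z powi j * (of_real (\<phi> z) * of_real (flat z)) - \<psi> z) \<le> e"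
    by (intro bexI[of _ ?\<psi>] ballI)
qed

text \<open>As \<open>flat\<close> vanishes only at 1, multiplying it by continuous approximations
  of its reciprocal recovers every power of z in mean square, that is, every basis vector.\<close>

lemma cyclic_bilateral_shift: "cyclic UNIV bilateral_shift"
  unfolding cyclic_iff_closed_subspace[OF bilateral_shift_map]
proof (intro bexI[of _ "fourier (\<lambda>z. of_real (flat z))"] allI impI)
  have cf: "continuous_on (sphere 0 1) (\<lambda>z. complex_of_real (flat z))"
    by (intro continuous_intros continuous_on_flat)
  then show "fourier (\<lambda>z. of_real (flat z)) \<in> ell2 UNIV"
    by (rule fourier_ell2)
  fix N assume N: "closed_subspace UNIV N"
    and orbit: "\<forall>n. (bilateral_shift ^^ n) (fourier (\<lambda>z. of_real (flat z))) \<in> N"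
  have orb: "(\<lambda>z. z ^ n * of_real (flat z)) \<in> fourier_vimage N" for n
    using orbit by (auto simp: fourier_vimage_def bilateral_shift_power_fourier
        intro!: continuous_intros continuous_on_flat)
  show "N = ell2 UNIV"
  proof (rule closed_subspace_eq_ell2[OF N])
    fix j :: int
    have "(\<lambda>z. z powi j) \<in> fourier_vimage N"
    proof (rule fourier_vimage_L2[OF N continuous_on_circle_powi])
      fix e :: real assume e: "e > 0"
      \<comment> \<open>A regularised reciprocal of \<open>flat\<close>: it is continuous, and its
        product with \<open>flat\<close> lies in [0, 1] and tends to 1 away from the point 1, so
        dominated convergence applies.\<close>
      define \<phi> where "\<phi> n z = 1 / (flat z + 1 / real (Suc n))" for n z
      have den: "flat z + 1 / real (Suc n) > 0" for n z
        by (intro add_nonneg_pos flat_nonneg) simp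
      have c\<phi>: "continuous_on (sphere 0 1) (\<phi> n)" for n
        unfolding \<phi>_def
        by (intro continuous_intros continuous_on_flat ballI) (use den in \<open>metis less_irrefl\<close>)
      define \<psi> where "\<psi> n z = z powi j * (of_real (\<phi> n z) * of_real (flat z))" for n z
      have \<psi>: "\<psi> n \<in> fourier_vimage N" for n
        unfolding \<psi>_def by (rule continuous_flat_in_vimage[OF N orb c\<phi>])
      let ?e = "\<lambda>t. cis (2 * pi * t)"
      let ?g = "\<lambda>n t. (cmod (?e t powi j - \<psi> n (?e t)))\<^sup>2"
      have g: "?g n t = (1 - \<phi> n (?e t) * flat (?e t))\<^sup>2" for n t
      proof -
        have "?e t powi j - \<psi> n (?e t) = ?e t powi j * of_real (1 - \<phi> n (?e t) * flat (?e t))"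
          by (simp add: \<psi>_def algebra_simps)
        then show ?thesis by (simp add: norm_mult norm_power_int del: of_real_diff of_real_mult)
      qed
      have unit: "0 \<le> \<phi> n z * flat z" "\<phi> n z * flat z \<le> 1" for n z
        using den[of z n] flat_nonneg[of z] by (auto simp: \<phi>_def)
      have "(\<lambda>n. integral {0..1} (?g n)) \<longlonglongrightarrow> integral {0..1} (\<lambda>t. if ?e t = 1 then 1 else 0 :: real)"
      proof (rule dominated_convergence(2))
        show "?g n integrable_on {0..1}" for n
          unfolding g
          by (intro integrable_continuous_interval continuous_intros continuous_on_flat
              continuous_on_circle_comp c\<phi>)
        show "(\<lambda>t. 1 :: real) integrable_on {0..1 :: real}" by (rule integrable_const_ivl)
        show "norm (?g n t) \<le> 1" for n t
          unfolding g using unit[of n "?e t"] by (simp add: power_le_one)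
        show "(\<lambda>n. ?g n t) \<longlonglongrightarrow> (if ?e t = 1 then 1 else 0)" for t
        proof (cases "?e t = 1")
          case True
          then show ?thesis unfolding g by (simp add: flat_def)
        next
          case False
          have "(\<lambda>n. 1 / real (Suc n)) \<longlonglongrightarrow> 0" by real_asymp
          then have "(\<lambda>n. (1 - 1 / (flat (?e t) + 1 / real (Suc n)) * flat (?e t))\<^sup>2)
              \<longlonglongrightarrow> (1 - 1 / (flat (?e t) + 0) * flat (?e t))\<^sup>2"
            using flat_pos[OF False] by (intro tendsto_intros) auto
          then show ?thesis
            unfolding g \<phi>_def using False flat_pos[OF False] by simp
        qed
      qed
      \<comment> \<open>The exceptional parameters are only the endpoints 0 and 1.\<close>
      moreover have "integral {0..1} (\<lambda>t. if ?e t = 1 then 1 else 0 :: real) = 0"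
      proof (rule integral_unique, rule has_integral_spike_finite[where f = "\<lambda>_. 0"])
        show "(if ?e t = 1 then 1 else 0 :: real) = 0" if "t \<in> {0..1} - {0, 1}" for t
        proof -
          have "?e t \<noteq> 1"
          proof
            assume "?e t = 1"
            then have "cos (2 * pi * t) = 1" by (metis cis.simps(1) one_complex.simps(1))
            then obtain x :: int where "2 * pi * t = of_int x * 2 * pi"
              using cos_one_2pi_int by blast
            then have "t = of_int x" by simp
            then show False using that by auto
          qed
          then show ?thesis by simp
        qed
      qed auto
      ultimately have "(\<lambda>n. integral {0..1} (?g n)) \<longlonglongrightarrow> 0" by simp
      then have "eventually (\<lambda>n. integral {0..1} (?g n) < e) sequentially"
        using e by (intro order_tendstoD) auto
      then obtain n where "integral {0..1} (?g n) < e"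
        using eventually_happens' sequentially_bot by blast
      then show "\<exists>\<psi>\<in>fourier_vimage N. integral {0..1} (\<lambda>t. (cmod (?e t powi j - \<psi> (?e t)))\<^sup>2) < e"
        using \<psi> by blast
    qed
    then show "ket j \<in> N" by (simp add: fourier_vimage_def fourier_powi)
  qed
qed

section \<open>Contractions outside the class \<open>C\<^sub>\<cdot>\<^sub>0\<close>\<close>

lemma ell2_sum_mult_le:
  assumes "f \<in> ell2 A" "g \<in> ell2 A" "finite F" "F \<subseteq> A"
  shows "(\<Sum>x\<in>F. cmod (f x * cnj (g x))) \<le> ell2_norm A f * ell2_norm A g"
proof -
  have "(\<Sum>x\<in>F. cmod (f x * cnj (g x))) = (\<Sum>x\<in>F. \<bar>cmod (f x)\<bar> * \<bar>cmod (g x)\<bar>)"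
    by (simp add: norm_mult)
  also have "\<dots> \<le> L2_set (\<lambda>x. cmod (f x)) F * L2_set (\<lambda>x. cmod (g x)) F"
    by (rule L2_set_mult_ineq)
  also have "\<dots> \<le> ell2_norm A f * ell2_norm A g"
    by (intro mult_mono L2_set_le_ell2_norm assms L2_set_nonneg ell2_norm_nonneg)
  finally show ?thesis .
qed

lemma ell2_inner_abs_summable:
  assumes "f \<in> ell2 A" "g \<in> ell2 A"
  shows "(\<lambda>x. cmod (f x * cnj (g x))) summable_on A"
  by (rule nonneg_bdd_above_summable_on)
    (use ell2_sum_mult_le[OF assms] in \<open>auto intro!: bdd_aboveI2[where M = "ell2_norm A f * ell2_norm A g"]\<close>)

lemma ell2_inner_summable:
  assumes "f \<in> ell2 A" "g \<in> ell2 A"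
  shows "(\<lambda>x. f x * cnj (g x)) summable_on A"
  using ell2_inner_abs_summable[OF assms] by (rule abs_summable_summable)

lemma ell2_inner_Cauchy_Schwarz:
  assumes "f \<in> ell2 A" "g \<in> ell2 A"
  shows "cmod (ell2_inner A f g) \<le> ell2_norm A f * ell2_norm A g"
proof -
  have "cmod (ell2_inner A f g) \<le> (\<Sum>\<^sub>\<infinity>x\<in>A. cmod (f x * cnj (g x)))"
    unfolding ell2_inner_def by (rule norm_infsum_bound[OF ell2_inner_abs_summable[OF assms]])
  also have "\<dots> \<le> ell2_norm A f * ell2_norm A g"
    by (rule infsum_le_finite_sums[OF ell2_inner_abs_summable[OF assms] ell2_sum_mult_le[OF assms]])
  finally show ?thesis .
qed

lemma ell2_inner_self:
  assumes "f \<in> ell2 A"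
  shows "ell2_inner A f f = of_real ((ell2_norm A f)\<^sup>2)"
proof -
  have eq: "f x * cnj (f x) = of_real ((cmod (f x))\<^sup>2)" for x
    by (rule complex_norm_square[symmetric])
  have "((\<lambda>x. (cmod (f x))\<^sup>2) has_sum (ell2_norm A f)\<^sup>2) A"
    unfolding ell2_norm_power2 by (rule has_sum_infsum[OF ell2_summable[OF assms]])
  then show ?thesis
    unfolding ell2_inner_def eq by (intro infsumI has_sum_of_real)
qed

lemma ell2_inner_ket:
  assumes "a \<in> A"
  shows "ell2_inner A (ket a) h = cnj (h a)"
proof -
  have "ell2_inner A (ket a) h = (\<Sum>\<^sub>\<infinity>x\<in>{a}. ket a x * cnj (h x))"
    unfolding ell2_inner_def by (rule infsum_cong_neutral) (use assms in \<open>auto simp: ket_def\<close>)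
  then show ?thesis by (simp add: ket_def)
qed

text \<open>Testing against basis vectors determines h, so exhibiting one candidate resolves the
  definite description.\<close>

lemma hilbert_adjoint_eqI:
  assumes h: "h \<in> ell2 A" and eq: "\<And>f. f \<in> ell2 A \<Longrightarrow> ell2_inner A (T f) g = ell2_inner A f h"
  shows "hilbert_adjoint A T g = h"
  unfolding hilbert_adjoint_def
proof (rule the_equality)
  fix h' assume h': "h' \<in> ell2 A \<and> (\<forall>f\<in>ell2 A. ell2_inner A (T f) g = ell2_inner A f h')"
  have "h' a = h a" for a
  proof (cases "a \<in> A")
    case True
    then have "ell2_inner A (ket a) h' = ell2_inner A (ket a) h"
      using h' eq[OF ell2_ket[OF True]] ell2_ket[OF True] by simp
    then show ?thesis using ell2_inner_ket[OF True] by simp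
  next
    case False
    then show ?thesis using ell2_outside[OF h] ell2_outside[of h' A] h' by simp
  qed
  then show "h' = h" by blast
qed (use assms in auto)

lemma contractive_norm_le:
  assumes "contractive A T" and f: "f \<in> ell2 A"
  shows "ell2_norm A (T f) \<le> ell2_norm A f"
proof (cases "f = 0")
  case True
  have "T \<in> ell2_maps A A"
    using assms by (simp add: contractive_def bounded_operators_eq)
  then show ?thesis unfolding True by (simp only: ell2_maps_zero order_refl)
next
  case False
  have T: "T \<in> ell2_maps A A" and le: "operator_norm A T \<le> 1"
    using assms by (simp_all add: contractive_def bounded_operators_eq)
  obtain M where M: "M > 0" "\<And>f. f \<in> ell2 A \<Longrightarrow> ell2_norm A (T f) \<le> M * ell2_norm A f"
    using ell2_maps_bound[OF T] by blast
  \<comment> \<open>The operator norm is a real supremum, which bounds the individual values only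
    once the set is known to be bounded above.\<close>
  have "bdd_above ((\<lambda>f. ell2_norm A (T f)) ` {f \<in> ell2 A. ell2_norm A f \<le> 1})"
  proof (rule bdd_aboveI2)
    fix f assume f: "f \<in> {f \<in> ell2 A. ell2_norm A f \<le> 1}"
    then have "ell2_norm A (T f) \<le> M * ell2_norm A f" using M by blast
    also have "\<dots> \<le> M * 1" using f M by (intro mult_left_mono) auto
    finally show "ell2_norm A (T f) \<le> M * 1" .
  qed
  then have unit: "ell2_norm A (T u) \<le> 1" if "u \<in> ell2 A" "ell2_norm A u \<le> 1" for u
    using cSUP_upper[of u "{f \<in> ell2 A. ell2_norm A f \<le> 1}" "\<lambda>f. ell2_norm A (T f)"] that le
    unfolding operator_norm_def by auto
  have pos: "ell2_norm A f > 0"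
    using False ell2_norm_eq_0_iff[OF f] by (simp add: order_less_le)
  have "ell2_norm A (T (scale_fun (of_real (1 / ell2_norm A f)) f)) \<le> 1"
    using pos by (intro unit ell2_scale f) (simp add: ell2_norm_scale norm_divide)
  then have "ell2_norm A (T f) / ell2_norm A f \<le> 1"
    using pos by (simp add: ell2_mapsD(3)[OF T f] ell2_norm_scale norm_divide)
  then show ?thesis using pos by simp
qed

text \<open>Closedness holds because all powers are contractions: the error g - y of an
  approximation stays small along the orbit. Membership in \<open>C_dot_0\<close> thereby reduces to
  basis vectors.\<close>

lemma closed_subspace_power_tendsto_zero:
  assumes T: "T \<in> ell2_maps A A" and contr: "\<And>f. f \<in> ell2 A \<Longrightarrow> ell2_norm A (T f) \<le> ell2_norm A f"
  shows "closed_subspace A {h \<in> ell2 A. (\<lambda>n. ell2_norm A ((T ^^ n) h)) \<longlonglongrightarrow> 0}" (is "closed_subspace A ?Z")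
proof (rule closed_subspaceI)
  have Tn: "(T ^^ n) \<in> ell2_maps A A" for n by (rule ell2_maps_power[OF T])
  have contr_n: "ell2_norm A ((T ^^ n) f) \<le> ell2_norm A f" if "f \<in> ell2 A" for f n
  proof (induction n)
    case (Suc n)
    then show ?case using contr[OF ell2_mapsD(1)[OF Tn[of n] that]] by simp
  qed simp
  show "0 \<in> ?Z" by (simp add: ell2_maps_zero[OF Tn])
  show "f + g \<in> ?Z" if f: "f \<in> ?Z" and g: "g \<in> ?Z" for f g
  proof -
    have lim: "(\<lambda>n. ell2_norm A ((T ^^ n) f) + ell2_norm A ((T ^^ n) g)) \<longlonglongrightarrow> 0"
      using f g by (auto intro: tendsto_add_zero)
    have "ell2_norm A ((T ^^ n) (f + g)) \<le> ell2_norm A ((T ^^ n) f) + ell2_norm A ((T ^^ n) g)" for n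
      using f g ell2_norm_add_le[OF ell2_mapsD(1)[OF Tn[of n], of f] ell2_mapsD(1)[OF Tn[of n], of g]]
      by (simp add: ell2_mapsD(2)[OF Tn])
    then have "(\<lambda>n. ell2_norm A ((T ^^ n) (f + g))) \<longlonglongrightarrow> 0"
      by (intro tendsto_sandwich[OF _ _ tendsto_const lim]) auto
    then show ?thesis using f g by (simp add: ell2_add)
  qed
  show "scale_fun c f \<in> ?Z" if f: "f \<in> ?Z" for c f
    using f by (auto simp: ell2_scale ell2_mapsD(3)[OF Tn] ell2_norm_scale intro: tendsto_mult_right_zero)
  show "g \<in> ?Z" if g: "g \<in> ell2 A" and ap: "\<And>e. e > 0 \<Longrightarrow> \<exists>y\<in>?Z. ell2_norm A (g - y) < e" for g
  proof -
    have "(\<lambda>n. ell2_norm A ((T ^^ n) g)) \<longlonglongrightarrow> 0"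
    proof (rule LIMSEQ_I)
      fix e :: real assume e: "e > 0"
      then obtain y where y: "y \<in> ?Z" "ell2_norm A (g - y) < e / 2"
        using ap[of "e / 2"] by auto
      then obtain N where N: "\<And>n. n \<ge> N \<Longrightarrow> ell2_norm A ((T ^^ n) y) < e / 2"
        using LIMSEQ_D[of "\<lambda>n. ell2_norm A ((T ^^ n) y)" 0 "e / 2"] e by auto
      have "ell2_norm A ((T ^^ n) g) < e" if "n \<ge> N" for n
      proof -
        have gy: "g - y \<in> ell2 A" using g y by (simp add: ell2_diff)
        have "(T ^^ n) g = (T ^^ n) (g - y) + (T ^^ n) y"
          using g y by (simp add: ell2_maps_diff[OF Tn])
        then have "ell2_norm A ((T ^^ n) g) \<le> ell2_norm A ((T ^^ n) (g - y)) + ell2_norm A ((T ^^ n) y)"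
          using gy y ell2_norm_add_le[OF ell2_mapsD(1)[OF Tn[of n], of "g - y"] ell2_mapsD(1)[OF Tn[of n], of y]]
          by simp
        then show ?thesis using contr_n[OF gy, of n] y(2) N[OF that] by linarith
      qed
      then show "\<exists>N. \<forall>n\<ge>N. norm (ell2_norm A ((T ^^ n) g) - 0) < e" by auto
    qed
    then show ?thesis using g by simp
  qed
qed auto

section \<open>The diagonal intertwiner and the adjoint of the tree shift\<close>

definition next_vertex :: "vertex \<Rightarrow> vertex" where
  "next_vertex v = (case v of Trunk k \<Rightarrow> Trunk (k + 1) | Branch j \<Rightarrow> Branch (j + 1))"

lemma inj_next_vertex: "inj_on next_vertex X"
  by (auto simp: inj_on_def next_vertex_def split: vertex.splits)

context tree_shift
begin

text \<open>The diagonal operator with entries \<open>cumprod\<close> is bounded by assumption, and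
  by \<open>cumprod_step\<close> it intertwines the unweighted shift with W. Its entries are
  nonzero, so its range contains the basis.\<close>

lemma cyclic_bilateral_of_bounded:
  assumes M: "\<And>k. cumprod (\<lambda>k. lam (Trunk k)) k \<le> M"
  shows "cyclic UNIV W"
proof -
  define y where "y = cumprod (\<lambda>k. lam (Trunk k))"
  have y: "y k > 0" "y k = lam (Trunk k) * y (k - 1)" for k
    unfolding y_def by (rule cumprod_trunk_pos, rule cumprod_step) (simp add: pos)
  define X where "X f k = complex_of_real (y k) * f k" for f :: "int \<Rightarrow> complex" and k
  have "(\<lambda>f k. if k \<in> UNIV then complex_of_real (y k) * f k else 0) \<in> ell2_maps UNIV UNIV"
    by (rule ell2_maps_weighted[where M = M and p = "\<lambda>k. k"]) (use M y(1) in \<open>auto simp: y_def abs_of_pos\<close>)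
  then have X: "X \<in> ell2_maps UNIV UNIV" by (simp add: X_def[abs_def])
  show ?thesis
  proof (rule cyclic_intertwining[OF bilateral_shift_map W_map X _ _ cyclic_bilateral_shift])
    show "X (bilateral_shift f) = W (X f)" if f: "f \<in> ell2 UNIV" for f
    proof
      fix k
      have "complex_of_real (y k) = complex_of_real (lam (Trunk k)) * complex_of_real (y (k - 1))"
        unfolding of_real_mult[symmetric] using y(2)[of k] by simp
      then show "X (bilateral_shift f) k = W (X f) k"
        unfolding W_apply[OF ell2_mapsD(1)[OF X f]] by (simp add: X_def bilateral_shift_def)
    qed
    show "ket k \<in> X ` ell2 UNIV" for k
    proof
      show "ket k = X (scale_fun (of_real (1 / y k)) (ket k))"
        using y(1)[of k] by (auto simp: X_def ket_def scale_fun_def fun_eq_iff)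
    qed (simp add: ell2_scale ell2_ket)
  qed
qed

text \<open>The edge from \<open>Trunk 0\<close> to \<open>Branch 1\<close> gets a summand of its
  own, because \<open>next_vertex\<close> follows only edges inside the trunk or inside the branch
  and so stays injective. The last branch vertex is excluded as it has no child.\<close>

definition S_adj :: "(vertex \<Rightarrow> complex) \<Rightarrow> vertex \<Rightarrow> complex" where
  "S_adj g = (\<lambda>u. if u \<in> V - {Branch k0} then complex_of_real (lam (next_vertex u)) * g (next_vertex u) else 0)
    + (\<lambda>u. if u \<in> {Trunk 0} then complex_of_real (lam (Branch 1)) * g (Branch 1) else 0)"

lemma next_vertex_image: "next_vertex ` (V - {Branch k0}) = V - {Branch 1}"
proof (intro equalityI subsetI)
  fix v assume v: "v \<in> V - {Branch 1}"
  show "v \<in> next_vertex ` (V - {Branch k0})"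
  proof (cases v)
    case (Trunk k)
    then have "v = next_vertex (Trunk (k - 1))" by (simp add: next_vertex_def)
    then show ?thesis by (intro image_eqI) auto
  next
    case (Branch j)
    then have "v = next_vertex (Branch (j - 1))" "Branch (j - 1) \<in> V - {Branch k0}"
      using v by (auto simp: next_vertex_def)
    then show ?thesis by blast
  qed
qed (auto simp: next_vertex_def tree_V_def)

lemma parent_next_vertex: "u \<in> V \<Longrightarrow> parent (next_vertex u) = u"
  by (cases u) (auto simp: next_vertex_def)

lemma Branch_1_in_V: "Branch 1 \<in> V"
  using k0 by simp

lemma S_adj_map: "S_adj \<in> ell2_maps V V"
  unfolding S_adj_def[abs_def]
proof (intro ell2_maps_add)
  obtain M where M: "\<And>v. v \<in> V \<Longrightarrow> \<bar>lam v\<bar> \<le> M"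
    using bounded by (auto simp: bounded_iff)
  show "(\<lambda>g u. if u \<in> V - {Branch k0} then complex_of_real (lam (next_vertex u)) * g (next_vertex u) else 0)
      \<in> ell2_maps V V"
  proof (rule ell2_maps_weighted[OF _ inj_next_vertex])
    fix u assume "u \<in> V - {Branch k0}"
    then have "next_vertex u \<in> V" using next_vertex_image by blast
    then show "cmod (complex_of_real (lam (next_vertex u))) \<le> M" using M by simp
  qed (use next_vertex_image in auto)
  show "(\<lambda>g u. if u \<in> {Trunk 0} then complex_of_real (lam (Branch 1)) * g (Branch 1) else 0) \<in> ell2_maps V V"
    by (rule ell2_maps_weighted[where M = "\<bar>lam (Branch 1)\<bar>"]) (use Branch_1_in_V in auto)
qed

text \<open>Splitting off the term at \<open>Branch 1\<close> leaves a sum over the other vertices,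
  which is reindexed by \<open>next_vertex\<close>; the split-off term is the extra summand of
  \<open>S_adj\<close> at \<open>Trunk 0\<close>.\<close>

lemma ell2_inner_S:
  assumes f: "f \<in> ell2 V" and g: "g \<in> ell2 V"
  shows "ell2_inner V (S f) g = ell2_inner V f (S_adj g)"
proof -
  let ?C = "V - {Branch k0}"
  let ?b = "complex_of_real (lam (Branch 1)) * f (Trunk 0) * cnj (g (Branch 1))"
  let ?s = "\<lambda>v. S f v * cnj (g v)" and ?a = "\<lambda>u. f u * cnj (S_adj g u)"
  let ?m = "\<lambda>u. complex_of_real (lam (next_vertex u)) * f u * cnj (g (next_vertex u))"
  have Sf: "S f \<in> ell2 V" by (rule ell2_mapsD(1)[OF S_map f])
  have Sg: "S_adj g \<in> ell2 V" by (rule ell2_mapsD(1)[OF S_adj_map g])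
  have sum_s: "?s summable_on V" by (rule ell2_inner_summable[OF Sf g])
  have sum_a: "?a summable_on V" by (rule ell2_inner_summable[OF f Sg])
  have "infsum ?s V = infsum ?s {Branch 1} + infsum ?s (V - {Branch 1})"
    using infsum_Un_disjoint[of ?s "{Branch 1}" "V - {Branch 1}"] Branch_1_in_V
      summable_on_subset[OF sum_s, of "V - {Branch 1}"]
    by (simp add: insert_absorb)
  also have "infsum ?s {Branch 1} = ?b"
    using Branch_1_in_V by (simp add: S_apply[OF f])
  also have "infsum ?s (V - {Branch 1}) = infsum (?s \<circ> next_vertex) ?C"
    unfolding next_vertex_image[symmetric] by (rule infsum_reindex[OF inj_next_vertex])
  also have "\<dots> = infsum ?m ?C"
  proof (rule infsum_cong)
    fix u assume u: "u \<in> ?C"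
    then have "next_vertex u \<in> V" using next_vertex_image by blast
    then show "(?s \<circ> next_vertex) u = ?m u"
      using u by (simp add: S_apply[OF f] parent_next_vertex)
  qed
  finally have L: "infsum ?s V = ?b + infsum ?m ?C" .
  have T0: "Trunk 0 \<in> ?C" by simp
  have m_sum: "?m summable_on ?C - {Trunk 0}"
  proof -
    have "?a summable_on ?C - {Trunk 0}" by (rule summable_on_subset[OF sum_a]) auto
    then show ?thesis
      by (rule summable_on_cong[THEN iffD1, rotated]) (simp add: S_adj_def)
  qed
  have "infsum ?a V = infsum ?a ?C"
    by (rule infsum_cong_neutral) (use k0 in \<open>auto simp: S_adj_def\<close>)
  also have "?C = {Trunk 0} \<union> (?C - {Trunk 0})" by auto
  also have "infsum ?a \<dots> = infsum ?a {Trunk 0} + infsum ?a (?C - {Trunk 0})"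
    by (rule infsum_Un_disjoint) (auto intro: summable_on_subset[OF sum_a])
  also have "infsum ?a (?C - {Trunk 0}) = infsum ?m (?C - {Trunk 0})"
    by (rule infsum_cong) (simp add: S_adj_def)
  also have "infsum ?a {Trunk 0} = ?b + infsum ?m {Trunk 0}"
    by (simp add: S_adj_def algebra_simps)
  also have "?b + infsum ?m {Trunk 0} + infsum ?m (?C - {Trunk 0}) = ?b + infsum ?m ?C"
    using infsum_Un_disjoint[of ?m "{Trunk 0}" "?C - {Trunk 0}"] T0 m_sum
    by (simp add: insert_absorb)
  finally show ?thesis using L by (simp add: ell2_inner_def)
qed

lemma hilbert_adjoint_S: "g \<in> ell2 V \<Longrightarrow> hilbert_adjoint V S g = S_adj g"
  by (rule hilbert_adjoint_eqI) (auto intro: ell2_mapsD(1)[OF S_adj_map] ell2_inner_S)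

lemma hilbert_adjoint_S_power:
  assumes "g \<in> ell2 V"
  shows "(hilbert_adjoint V S ^^ n) g = (S_adj ^^ n) g"
  by (induction n) (simp_all add: hilbert_adjoint_S ell2_mapsD(1)[OF ell2_maps_power[OF S_adj_map] assms])

text \<open>For h = \<open>S_adj g\<close>, the square of the norm of h is the inner product of S h
  with g, hence at most the product of the norms of h and g.\<close>

lemma S_adj_norm_le:
  assumes contr: "contractive V S" and g: "g \<in> ell2 V"
  shows "ell2_norm V (S_adj g) \<le> ell2_norm V g"
proof (cases "ell2_norm V (S_adj g) = 0")
  case False
  have Sg: "S_adj g \<in> ell2 V" by (rule ell2_mapsD(1)[OF S_adj_map g])
  have "(ell2_norm V (S_adj g))\<^sup>2 = cmod (ell2_inner V (S (S_adj g)) g)"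
    unfolding ell2_inner_S[OF Sg g] ell2_inner_self[OF Sg] by (simp add: norm_power)
  also have "\<dots> \<le> ell2_norm V (S (S_adj g)) * ell2_norm V g"
    by (rule ell2_inner_Cauchy_Schwarz[OF ell2_mapsD(1)[OF S_map Sg] g])
  also have "\<dots> \<le> ell2_norm V (S_adj g) * ell2_norm V g"
    by (intro mult_right_mono contractive_norm_le[OF contr Sg]) simp
  finally show ?thesis
    using False by (simp add: power2_eq_square order_less_le)
qed simp

lemma S_adj_ket:
  assumes "v \<in> V"
  shows "S_adj (ket v) = scale_fun (complex_of_real (lam v)) (ket (parent v))"
proof
  fix u
  show "S_adj (ket v) u = scale_fun (complex_of_real (lam v)) (ket (parent v)) u"
  proof (cases v)
    case (Trunk k)
    then show ?thesis
      by (cases u) (auto simp: S_adj_def ket_def scale_fun_def next_vertex_def)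
  next
    case (Branch j)
    then show ?thesis using assms
      by (cases u) (auto simp: S_adj_def ket_def scale_fun_def next_vertex_def parent_def)
  qed
qed

section \<open>Orbits of the adjoint and the cumulative products of the weights\<close>

lemma weight_le_one:
  assumes contr: "contractive V S" and v: "v \<in> V"
  shows "lam v \<le> 1"
proof -
  have p: "ket (parent v) \<in> ell2 V" using parent_in_tree_V[OF v] by (rule ell2_ket)
  \<comment> \<open>The coordinate on the left is the weight \<open>lam v\<close>.\<close>
  have "cmod (S (ket (parent v)) v) \<le> ell2_norm V (S (ket (parent v)))"
    using L2_set_le_ell2_norm[OF ell2_mapsD(1)[OF S_map p], of "{v}"] v by simp
  also have "\<dots> \<le> 1"
    using contractive_norm_le[OF contr p] ell2_norm_ket[OF parent_in_tree_V[OF v]] by simp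
  finally show ?thesis
    using v pos[OF v] unfolding S_apply[OF p] by (simp add: ket_def)
qed

text \<open>The norm of \<open>S*\<^sup>n e\<^sub>0\<close> is the reciprocal of \<open>cumprod\<close> at \<open>-n\<close>; if these tend to \<open>0\<close>, then so do
  the orbits of all basis vectors, since \<open>S*\<close> moves them along \<open>parent\<close> to and from \<open>e\<^sub>0\<close>.\<close>

lemma C_dot_0_of_unbounded:
  assumes contr: "contractive V S" and unb: "\<And>M. \<exists>k. cumprod (\<lambda>k. lam (Trunk k)) k > M"
  shows "S \<in> C_dot_0 V"
proof -
  define y where "y = cumprod (\<lambda>k. lam (Trunk k))"
  have y: "y k > 0" "y k = lam (Trunk k) * y (k - 1)" for k
    unfolding y_def by (rule cumprod_trunk_pos, rule cumprod_step) (simp add: pos)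
  \<comment> \<open>The weights are at most 1, so y is decreasing and can be unbounded only towards
    minus infinity.\<close>
  have step: "y k \<le> y (k - 1)" for k
    using y(1)[of "k - 1"] weight_le_one[OF contr, of "Trunk k"]
    by (subst y(2)) (simp add: mult_left_le_one_le pos less_imp_le)
  have anti: "y k \<le> y l" if "l \<le> k" for k l
    using that
  proof (induction k rule: int_ge_induct)
    case (step i)
    then show ?case using \<open>\<And>k. y k \<le> y (k - 1)\<close>[of "i + 1"] by simp
  qed simp
  define Z where "Z = {h \<in> ell2 V. (\<lambda>n. ell2_norm V ((S_adj ^^ n) h)) \<longlonglongrightarrow> 0}"
  have Z: "closed_subspace V Z"
    unfolding Z_def by (rule closed_subspace_power_tendsto_zero[OF S_adj_map S_adj_norm_le[OF contr]])
  \<comment> \<open>Passing from h to \<open>S_adj h\<close> drops the first term of the sequence of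
    norms, which does not affect its limit.\<close>
  have "S_adj h \<in> Z \<longleftrightarrow> h \<in> Z" if h: "h \<in> ell2 V" for h
    using h ell2_mapsD(1)[OF S_adj_map h] filterlim_sequentially_Suc[of "\<lambda>n. ell2_norm V ((S_adj ^^ n) h)" "nhds 0"]
    by (simp add: Z_def funpow_swap1)
  then have parent_iff: "ket (parent v) \<in> Z \<longleftrightarrow> ket v \<in> Z" if v: "v \<in> V" for v
    using ell2_ket[OF v] S_adj_ket[OF v] closed_subspace_scale_iff[OF Z, of "complex_of_real (lam v)"] pos[OF v]
    by (metis less_irrefl of_real_eq_0_iff)
  have pow: "(S_adj ^^ n) (ket (Trunk 0)) = scale_fun (of_real (1 / y (- int n))) (ket (Trunk (- int n)))" for n
  proof (induction n)
    case 0
    then show ?case by (simp add: y_def cumprod_def)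
  next
    case (Suc n)
    have e: "- int n - 1 = - int (Suc n)" by simp
    have "1 / y (- int n) * lam (Trunk (- int n)) = 1 / y (- int (Suc n))"
      using y(2)[of "- int n"] y(1)[of "- int n"] y(1)[of "- int (Suc n)"] pos[of "Trunk (- int n)"]
      unfolding e by (simp add: field_simps)
    then have "complex_of_real (1 / y (- int n)) * complex_of_real (lam (Trunk (- int n)))
        = complex_of_real (1 / y (- int (Suc n)))"
      unfolding of_real_mult[symmetric] by simp
    moreover have "parent (Trunk (- int n)) = Trunk (- int (Suc n))" by simp
    ultimately show ?case
      using Suc by (simp add: ell2_mapsD(3)[OF S_adj_map] ell2_ket S_adj_ket
          del: of_real_divide of_nat_Suc parent_simps)
  qed
  have "(\<lambda>n. ell2_norm V ((S_adj ^^ n) (ket (Trunk 0)))) \<longlonglongrightarrow> 0"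
  proof (rule LIMSEQ_I)
    fix e :: real assume e: "e > 0"
    obtain k where k: "y k > 1 / e" using unb unfolding y_def by blast
    have "norm (ell2_norm V ((S_adj ^^ n) (ket (Trunk 0))) - 0) < e" if "n \<ge> nat (- k)" for n
    proof -
      \<comment> \<open>Monotonicity turns the single large value at k into a bound for all later
        n.\<close>
      have "1 / e < y (- int n)" using k anti[of "- int n" k] that by linarith
      then have "1 / y (- int n) < e"
        using e y(1)[of "- int n"] by (simp add: field_simps)
      then show ?thesis
        using y(1)[of "- int n"] unfolding pow by (simp add: ell2_norm_scale ell2_norm_ket norm_divide)
    qed
    then show "\<exists>N. \<forall>n\<ge>N. norm (ell2_norm V ((S_adj ^^ n) (ket (Trunk 0))) - 0) < e" by blast
  qed
  then have Z0: "ket (Trunk 0) \<in> Z" by (simp add: Z_def ell2_ket)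
  have trunk: "ket (Trunk k) \<in> Z" for k
  proof (induction k rule: int_induct[of _ 0])
    case (step1 i)
    then show ?case using parent_iff[of "Trunk (i + 1)"] by simp
  next
    case (step2 i)
    then show ?case using parent_iff[of "Trunk i"] by simp
  qed (rule Z0)
  have branch: "ket (Branch (Suc j)) \<in> Z" if "Suc j \<le> k0" for j
    using that
  proof (induction j)
    case 0
    then show ?case using parent_iff[of "Branch (Suc 0)"] Z0 by simp
  next
    case (Suc j)
    then show ?case using parent_iff[of "Branch (Suc (Suc j))"] by simp
  qed
  have "Z = ell2 V"
  proof (rule closed_subspace_eq_ell2[OF Z])
    fix v assume v: "v \<in> V"
    show "ket v \<in> Z"
    proof (cases v)
      case (Branch j)
      then show ?thesis using branch[of "j - 1"] v by simp
    qed (simp add: trunk)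
  qed
  then show ?thesis
    using contr by (auto simp: C_dot_0_def Z_def hilbert_adjoint_S_power)
qed

text \<open>By contraposition of \<open>C_dot_0_of_unbounded\<close> the cumulative products are
  bounded, so W is cyclic, and then so is S.\<close>

lemma cyclic_of_not_C_dot_0:
  assumes "contractive V S" "S \<notin> C_dot_0 V"
  shows "cyclic V S"
proof -
  obtain M where "\<And>k. cumprod (\<lambda>k. lam (Trunk k)) k \<le> M"
    using C_dot_0_of_unbounded[OF assms(1)] assms(2) by (metis not_le)
  then show ?thesis
    using cyclic_bilateral_of_bounded cyclic_tree by blast
qed

end

theorem theorem6p4:
  fixes k0 :: nat
    and lam :: "vertex \<Rightarrow> real"
    and S :: "(vertex \<Rightarrow> complex) \<Rightarrow> (vertex \<Rightarrow> complex)"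
    and W :: "(int \<Rightarrow> complex) \<Rightarrow> (int \<Rightarrow> complex)"
  assumes "k0 \<ge> 1"
    and "\<forall>v\<in>tree_V k0. lam v > 0"
    and "bounded (lam ` tree_V k0)"
    and "is_weighted_shift (tree_V k0) (tree_E k0) lam S"
    and "is_bilateral_shift (\<lambda>k. lam (Trunk k)) W"
  shows "(cyclic (tree_V k0) S \<longleftrightarrow> cyclic UNIV W) \<and>
    (contractive (tree_V k0) S \<and> S \<notin> C_dot_0 (tree_V k0) \<longrightarrow> cyclic (tree_V k0) S)"
proof -
  interpret tree_shift k0 lam S W
    by unfold_locales (use assms in auto)
  show ?thesis
    using cyclic_bilateral cyclic_tree cyclic_of_not_C_dot_0 by blast
qed

end
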